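(* Let $d\geq 2$ and let $\phi\colon (0,\infty)\to(0,\infty)$ be an unbounded, increasing, concave function. Then there is an uncountable family $(X_{\psi})_{\psi\in\Lambda}$ of pairwise bilipschitz non-equivalent separated nets in $\mathbb{R}^{d}$ such that each $X_{\psi}$ is $\phi$-displacement equivalent to $\mathbb{Z}^{d}$.
   Context: A set $Z\subseteq\mathbb{R}^d$ is separated if $\inf\{\|z-z'\|_2: z,z'\in Z,\ z\ne z'\}>0$, and a net of $\mathbb{R}^d$ if $\sup_{x\in\mathbb{R}^d}\inf_{z\in Z}\|z-x\|_2<\infty$; a separated net is a set that is both. A function $\phi$ is increasing if $s\le t$ implies $\phi(s)\le\phi(t)$. For $f\colon A\subseteq\mathbb{R}^d\to\mathbb{R}^d$ and $R>0$, $\operatorname{disp}_R(f):=\sup\{\|f(x)-x\|_2: x\in A,\ \|x\|_2\le R\}$, with $\operatorname{disp}_R(f):=0$ if $A\cap\overline{B}(\mathbf{0},R)=\emptyset$. Separated nets $X,Y\subseteq\mathbb{R}^d$ are called $\phi$-displacement equivalent if there is a bijection $f\colon X\to Y$ with $\operatorname{disp}_R(f)\in O(\phi(R))$, i.e. $\limsup_{R\to\infty}\operatorname{disp}_R(f)/\phi(R)<\infty$. Separated nets $X,Y\subseteq\mathbb{R}^d$ are bilipschitz equivalent if there is a bijection $X\to Y$ that is Lipschitz with Lipschitz inverse (with respect to the Euclidean distance). *)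

theory Defs
  imports "HOL-Analysis.Analysis"
begin

text \<open>Infima and suprema are taken in \<^typ>\<open>ereal\<close>, so that they follow the usual
  conventions for empty and for unbounded sets of distances: sets with at most one point are
  separated, and the empty set is not a net.\<close>

definition separated :: "'a::euclidean_space set \<Rightarrow> bool" where
  "separated Z \<longleftrightarrow> 0 < Inf {ereal (norm (z - z')) | z z'. z \<in> Z \<and> z' \<in> Z \<and> z \<noteq> z'}"

definition net :: "'a::euclidean_space set \<Rightarrow> bool" where
  "net Z \<longleftrightarrow> (SUP x. INF z\<in>Z. ereal (norm (z - x))) < \<infinity>"

definition separated_net :: "'a::euclidean_space set \<Rightarrow> bool" where
  "separated_net Z \<longleftrightarrow> separated Z \<and> net Z"

text \<open>\<open>disp A f R\<close> is the displacement on the closed ball of radius \<open>R\<close> of \<open>f\<close>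
  regarded as a map with domain \<open>A\<close>. The case distinction is needed because the supremum of
  the empty set in \<^typ>\<open>ereal\<close> is \<open>-\<infinity>\<close>.\<close>

definition disp :: "'a::euclidean_space set \<Rightarrow> ('a \<Rightarrow> 'a) \<Rightarrow> real \<Rightarrow> ereal" where
  "disp A f R =
     (if A \<inter> cball 0 R = {} then 0 else (SUP x\<in>A \<inter> cball 0 R. ereal (norm (f x - x))))"

definition displacement_equivalent ::
    "(real \<Rightarrow> real) \<Rightarrow> 'a::euclidean_space set \<Rightarrow> 'a set \<Rightarrow> bool" where
  "displacement_equivalent \<phi> X Y \<longleftrightarrow>
     (\<exists>f. bij_betw f X Y \<and> Limsup at_top (\<lambda>R. disp X f R / ereal (\<phi> R)) < \<infinity>)"

definition bilipschitz_equivalent :: "'a::euclidean_space set \<Rightarrow> 'a set \<Rightarrow> bool" where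
  "bilipschitz_equivalent X Y \<longleftrightarrow>
     (\<exists>f. bij_betw f X Y \<and> (\<exists>L. L-lipschitz_on X f) \<and> (\<exists>M. M-lipschitz_on Y (inv_into X f)))"

definition integer_lattice :: "(real ^ 'n) set" where
  "integer_lattice = {x. \<forall>i. x $ i \<in> \<int>}"

end

theory Submission
  imports Defs
begin

text \<open>Two separated nets are distinguished by finite patches of irregular density. The basic fact,
  \<open>rigid_patch_exists\<close>, says that for every \<open>L\<close> one can add finitely many points to the integer
  lattice such that no \<open>L\<close>-bilipschitz map maps a ball of the enriched lattice into the lattice and
  attains all lattice points near the image of the centre. It is a discrete version of the theorem
  of Burago and Kleiner, and of McMullen, that not every density is the Jacobian of a bilipschitz map.

  The idea of its proof is a gain of stretch. Suppose that \<open>f\<close> is such a map and stretches a pair of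
  points in direction \<open>a\<close> by a factor \<open>\<alpha>\<close>. Around the segment between them there is a thin tube
  consisting of cubes whose densities are alternately 2 and 1. If \<open>f\<close> stretches no pair at the next
  finer scale by more than \<open>(1 + k) * \<alpha>\<close>, then the images of most small steps along the tube are
  almost the same vector (\<open>almost_constant_steps\<close>). So \<open>f\<close> restricted to a sparse cube is nearly a
  translate of \<open>f\<close> restricted to a dense neighbour. A translation by a lattice vector preserves the
  lattice, hence pulling it back by \<open>f\<close> injects the dense cube into a small neighbourhood of the
  sparse one (\<open>translated_preimage\<close>), which has too few points. Consequently the stretch
  grows by the factor \<open>1 + k\<close> from each scale to the next (\<open>stretch_gain\<close>), and with enough scales it
  exceeds \<open>L\<close>. Tubes of all scales are present simultaneously because finer ones occupy a
  small proportion of every coarser cube; here a second direction \<open>b\<close> is needed.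

  The nets arise from the lattice by inserting rigid patches for \<open>L = 1, 2, 3, \<dots>\<close> at very sparse
  positions along an axis, one for each index in a set \<open>\<psi>\<close> of natural numbers. Near a patch as many
  lattice points are removed as were added; matching them moves points by an amount that depends on
  the patch only, and since \<open>\<phi>\<close> is increasing and unbounded this is at most \<open>\<phi> R\<close> if the patch is
  far enough out. A bilipschitz map distorts the distance to the origin by a bounded factor,
  so if it is to carry the net of \<open>\<psi>\<close> to that of \<open>\<psi>'\<close> and \<open>k\<close> is a large element of \<open>\<psi> - \<psi>'\<close>, it
  must map patch \<open>k\<close> to a region in which the net of \<open>\<psi>'\<close> is the plain lattice, which is
  impossible. Therefore an uncountable family of sets \<open>\<psi>\<close> with pairwise infinite differences gives
  the required nets.\<close>

section \<open>Lattice points and cubes\<close>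

definition emb :: "int ^ 'n \<Rightarrow> real ^ 'n" where
  "emb z = (\<chi> i. real_of_int (z $ i))"

lemma emb_component [simp]: "emb z $ i = real_of_int (z $ i)"
  by (simp add: emb_def)

lemma emb_add: "emb (z + w) = emb z + emb w"
  and emb_diff: "emb (z - w) = emb z - emb w"
  and emb_zero [simp]: "emb 0 = 0"
  and emb_axis: "emb (axis a s) = axis a (real_of_int s)"
  by (simp_all add: vec_eq_iff axis_def)

lemma emb_eq_iff [simp]: "emb z = emb w \<longleftrightarrow> z = w"
  by (simp add: vec_eq_iff)

lemma integer_lattice_eq_range_emb: "integer_lattice = range emb"
proof
  show "integer_lattice \<subseteq> range (emb :: int ^ 'n \<Rightarrow> _)"
  proof
    fix x :: "real ^ 'n" assume "x \<in> integer_lattice"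
    then have "x = emb (\<chi> i. \<lfloor>x $ i\<rfloor>)"
      by (simp add: integer_lattice_def vec_eq_iff)
    then show "x \<in> range emb" by blast
  qed
qed (auto simp: integer_lattice_def)

lemma axis_nth: "axis a s $ i = (if i = a then s else 0)" for s :: int
  by (simp add: axis_def)

lemma norm_axis_of_nat: "norm (axis a (real s) :: real ^ 'n::finite) = real s"
  by (simp add: norm_eq_sqrt_inner inner_axis_axis)

lemma norm_le_card_mult:
  fixes x :: "real ^ 'n" and r :: real
  assumes "\<And>i. \<bar>x $ i\<bar> \<le> r"
  shows "norm x \<le> CARD('n) * r"
proof -
  have "norm x \<le> (\<Sum>i\<in>UNIV. \<bar>x $ i\<bar>)" by (rule norm_le_l1_cart)
  also have "\<dots> \<le> (\<Sum>i\<in>(UNIV :: 'n set). r)" by (intro sum_mono assms)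
  finally show ?thesis by simp
qed

text \<open>The extra points sit at cell centres. All coordinates of lattice points and extra points lie in
\<open>(1/2)\<int>\<close>, so any set of such points is separated.\<close>

definition half :: "real ^ 'n" where
  "half = (\<chi> i. 1 / 2)"

lemma half_component [simp]: "half $ i = 1 / 2"
  by (simp add: half_def)

lemma emb_neq_emb_half [simp]: "emb z \<noteq> emb w + half" "emb w + half \<noteq> emb z"
proof -
  have False if "emb z = emb w + half"
  proof -
    from that have "real_of_int (z $ undefined) = real_of_int (w $ undefined) + 1 / 2"
      by (metis emb_component half_component vector_add_component)
    then have "real_of_int (2 * z $ undefined) = real_of_int (2 * w $ undefined + 1)" by simp
    then have "2 * z $ undefined = 2 * w $ undefined + 1" by linarith
    then show False by presburger
  qed
  then show "emb z \<noteq> emb w + half" "emb w + half \<noteq> emb z" by metis+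
qed

text \<open>One extra point in each lattice cell of \<open>S\<close> that belongs to \<open>E\<close>: the density is 2 on \<open>E\<close> and 1
elsewhere.\<close>

definition enriched :: "(int ^ 'n) set \<Rightarrow> (int ^ 'n) set \<Rightarrow> (real ^ 'n) set" where
  "enriched E S = emb ` S \<union> (\<lambda>z. emb z + half) ` (E \<inter> S)"

lemma card_enriched:
  fixes S :: "(int ^ 'n) set"
  assumes "finite S"
  shows "card (enriched E S) = card S + card (E \<inter> S)"
proof -
  have "card (emb ` S :: (real ^ 'n) set) = card S"
    by (rule card_image) (simp add: inj_on_def)
  moreover have "card ((\<lambda>z. emb z + half :: real ^ 'n) ` (E \<inter> S)) = card (E \<inter> S)"
    by (rule card_image) (simp add: inj_on_def)
  moreover have "emb ` S \<inter> (\<lambda>z. emb z + half :: real ^ 'n) ` (E \<inter> S) = {}"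
    by auto
  ultimately show ?thesis
    unfolding enriched_def using assms by (subst card_Un_disjoint) auto
qed

lemma finite_enriched: "finite S \<Longrightarrow> finite (enriched E S)"
  by (simp add: enriched_def)

lemma
  fixes A :: "'n::finite \<Rightarrow> 'b set"
  shows card_vectors: "card {z :: 'b ^ 'n. \<forall>i. z $ i \<in> A i} = (\<Prod>i\<in>UNIV. card (A i))"
    and finite_vectors: "(\<And>i. finite (A i)) \<Longrightarrow> finite {z :: 'b ^ 'n. \<forall>i. z $ i \<in> A i}"
proof -
  have "bij_betw vec_nth {z :: 'b ^ 'n. \<forall>i. z $ i \<in> A i} (PiE UNIV A)"
    by (rule bij_betw_byWitness[where f' = vec_lambda]) (auto simp: PiE_def)
  then show "card {z :: 'b ^ 'n. \<forall>i. z $ i \<in> A i} = (\<Prod>i\<in>UNIV. card (A i))"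
    and "(\<And>i. finite (A i)) \<Longrightarrow> finite {z :: 'b ^ 'n. \<forall>i. z $ i \<in> A i}"
    by (auto simp: bij_betw_same_card card_PiE bij_betw_finite finite_PiE)
qed

definition cube :: "int ^ 'n \<Rightarrow> int \<Rightarrow> (int ^ 'n) set" where
  "cube c s = {z. \<forall>i. z $ i \<in> {c $ i..<c $ i + s}}"

lemma finite_cube [simp]: "finite (cube c s)"
  unfolding cube_def by (rule finite_vectors) simp

lemma card_cube: "card (cube (c :: int ^ 'n) s) = nat s ^ CARD('n)"
  unfolding cube_def by (subst card_vectors) simp

text \<open>A tube of the construction restricts only one coordinate, so the share of a cube that it occupies
is a one-dimensional quantity.\<close>

lemma card_cube_slab:
  fixes c :: "int ^ 'n"
  shows "card {z \<in> cube c s. z $ b \<in> B} = card (B \<inter> {c $ b..<c $ b + s}) * nat s ^ (CARD('n) - 1)"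
proof -
  let ?A = "\<lambda>i. if i = b then B \<inter> {c $ b..<c $ b + s} else {c $ i..<c $ i + s}"
  have "{z \<in> cube c s. z $ b \<in> B} = {z. \<forall>i. z $ i \<in> ?A i}"
    by (auto simp: cube_def split: if_splits)
  then have "card {z \<in> cube c s. z $ b \<in> B} = (\<Prod>i\<in>UNIV. card (?A i))"
    by (simp only: card_vectors)
  also have "\<dots> = card (?A b) * (\<Prod>i\<in>UNIV - {b}. card (?A i))"
    by (rule prod.remove) auto
  also have "(\<Prod>i\<in>UNIV - {b}. card (?A i)) = (\<Prod>i\<in>UNIV - {b}. nat s)"
    by (rule prod.cong) auto
  finally show ?thesis by simp
qed

lemma int_div_pos_less: "t div p < k" if "t < p * k" "0 < p" for t p k :: int
proof (rule ccontr)
  assume "\<not> t div p < k"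
  then have "p * k \<le> p * (t div p)" using that by simp
  also have "\<dots> \<le> t" using that using mult_div_mod_eq[of p t] pos_mod_sign[of p t] that by linarith
  finally show False using that by simp
qed

lemma card_residues_in_interval:
  fixes c :: int and p h w :: nat
  assumes "int p dvd c" "0 < p"
  shows "card ({t. t mod int p < int w} \<inter> {c..<c + int (h * p)}) \<le> h * w"
proof -
  obtain q where q: "c = int p * q" using assms by (auto elim: dvdE)
  let ?S = "{t. t mod int p < int w} \<inter> {c..<c + int (h * p)}"
  let ?g = "\<lambda>t. (t div int p, t mod int p)"
  have "inj_on ?g ?S"
    by (rule inj_onI) (metis Pair_inject mult_div_mod_eq)
  moreover have "?g ` ?S \<subseteq> {q..<q + int h} \<times> {0..<int w}"
  proof (clarsimp, intro conjI)
    fix t assume "c \<le> t" "t < c + int h * int p"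
    then have "int p * q \<le> t" "t < int p * (q + int h)"
      by (auto simp: q algebra_simps)
    then show "q \<le> t div int p" "t div int p < q + int h"
      using \<open>0 < p\<close> zdiv_mono1[of "int p * q" t "int p"] nonzero_mult_div_cancel_left[of "int p"]
        int_div_pos_less[of t "int p" "q + int h"]
      by auto
  qed (use \<open>0 < p\<close> in auto)
  ultimately have "card ?S \<le> card ({q..<q + int h} \<times> {0..<int w})"
    by (intro card_inj_on_le) auto
  then show ?thesis by (simp add: card_cartesian_product)
qed

text \<open>If each sequence \<open>\<delta> q\<close> has mean at most \<open>\<eta>\<close>, then at some even index all of them are small
at once. The even indices are singled out because they belong to the dense cubes of a tube; they
carry half of the terms, whence the factor 2.\<close>

lemma pigeonhole_even:
  fixes \<delta> :: "'q \<Rightarrow> nat \<Rightarrow> real"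
  assumes "finite Q" "0 < h"
    and nonneg: "\<And>q i. q \<in> Q \<Longrightarrow> i < 2 * h \<Longrightarrow> 0 \<le> \<delta> q i"
    and le: "\<And>q. q \<in> Q \<Longrightarrow> (\<Sum>i<2 * h. \<delta> q i) \<le> real (2 * h) * \<eta>"
  obtains j where "j < h" "\<And>q. q \<in> Q \<Longrightarrow> \<delta> q (2 * j) \<le> 2 * real (card Q) * \<eta>"
proof -
  have even_part: "(\<Sum>j<h. \<delta> q (2 * j)) \<le> (\<Sum>i<2 * h. \<delta> q i)" if "q \<in> Q" for q
  proof -
    have "(\<Sum>j<h. \<delta> q (2 * j)) = (\<Sum>i\<in>(*) 2 ` {..<h}. \<delta> q i)"
      by (subst sum.reindex) (auto simp: inj_on_def)
    also have "\<dots> \<le> (\<Sum>i<2 * h. \<delta> q i)"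
      by (rule sum_mono2) (use nonneg that in auto)
    finally show ?thesis .
  qed
  have "(\<Sum>j<h. \<Sum>q\<in>Q. \<delta> q (2 * j)) = (\<Sum>q\<in>Q. \<Sum>j<h. \<delta> q (2 * j))"
    by (rule sum.swap)
  also have "\<dots> \<le> (\<Sum>q\<in>Q. real (2 * h) * \<eta>)"
    by (intro sum_mono order_trans[OF even_part le])
  also have "\<dots> = (\<Sum>j<h. 2 * real (card Q) * \<eta>)" by simp
  finally have total: "(\<Sum>j<h. \<Sum>q\<in>Q. \<delta> q (2 * j)) \<le> (\<Sum>j<h. 2 * real (card Q) * \<eta>)" .
  obtain j where j: "j < h" "(\<Sum>q\<in>Q. \<delta> q (2 * j)) \<le> 2 * real (card Q) * \<eta>"
  proof (rule ccontr)
    assume "\<not> thesis"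
    with that have "\<And>j. j < h \<Longrightarrow> 2 * real (card Q) * \<eta> < (\<Sum>q\<in>Q. \<delta> q (2 * j))"
      by force
    then have "(\<Sum>j<h. 2 * real (card Q) * \<eta>) < (\<Sum>j<h. \<Sum>q\<in>Q. \<delta> q (2 * j))"
      using \<open>0 < h\<close> by (intro sum_strict_mono) auto
    with total show False by simp
  qed
  show thesis
  proof (rule that[OF j(1)])
    fix q assume "q \<in> Q"
    have "\<delta> q (2 * j) \<le> (\<Sum>q\<in>Q. \<delta> q (2 * j))"
      by (rule member_le_sum[OF \<open>q \<in> Q\<close>]) (use nonneg j(1) \<open>finite Q\<close> in auto)
    with j(2) show "\<delta> q (2 * j) \<le> 2 * real (card Q) * \<eta>" by simp
  qed
qed

text \<open>The quantitative form of strict convexity of the ball: a vector of length at most \<open>U\<close> whose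
projection to a unit vector \<open>e\<close> almost attains \<open>U\<close> is close to \<open>U\<close> times \<open>e\<close>.\<close>

lemma near_maximal_projection:
  fixes u e :: "'a::real_inner"
  assumes "norm u \<le> U" "norm e = 1" "U - \<eta> \<le> u \<bullet> e" "0 \<le> U"
  shows "(norm (u - U *\<^sub>R e))\<^sup>2 \<le> 2 * U * \<eta>"
proof -
  have "(norm (u - U *\<^sub>R e))\<^sup>2 = (norm u)\<^sup>2 + (norm (U *\<^sub>R e))\<^sup>2 - 2 * (u \<bullet> (U *\<^sub>R e))"
    using dot_norm_neg[of u "U *\<^sub>R e"] by simp
  also have "\<dots> = (norm u)\<^sup>2 + U\<^sup>2 - 2 * U * (u \<bullet> e)"
    using \<open>norm e = 1\<close> by simp
  finally have "(norm (u - U *\<^sub>R e))\<^sup>2 = (norm u)\<^sup>2 + U\<^sup>2 - 2 * U * (u \<bullet> e)" .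
  moreover have "(norm u)\<^sup>2 \<le> U\<^sup>2" using assms by (simp add: power_mono)
  moreover have "2 * U * (U - \<eta>) \<le> 2 * U * (u \<bullet> e)" using assms by (intro mult_left_mono) auto
  ultimately show ?thesis by (simp add: power2_eq_square algebra_simps)
qed

section \<open>Nested tubes of alternating density\<close>

text \<open>There are \<open>m\<close> scales. At scale \<open>n\<close> a tube has width \<open>width n\<close> and is cut into cubes of that side,
alternately dense and sparse in direction \<open>a\<close>. Tubes of scale \<open>n\<close> repeat in direction \<open>b\<close> with
period \<open>mesh (Suc n)\<close>, which is \<open>K\<close> times their width, so they fill only the fraction \<open>1 / K\<close> of
space. Since \<open>K\<close> may be chosen much larger than the number of scales, the finer tubes that run
through a cube do not spoil its density. The mesh of scale \<open>n\<close> divides a cube of that scale into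
\<open>M\<close> parts in each direction; it is the lattice at which the tubes of the next finer scale begin,
so there is such a tube along every chain of steps that starts in a mesh point.\<close>

locale nested_tubes =
  fixes a b :: "'n::finite" and M K m :: nat
  assumes coordinates_distinct: "a \<noteq> b" and M_pos: "0 < M" and K_pos: "0 < K"
begin

definition mesh :: "nat \<Rightarrow> nat" where
  "mesh n = (M * K) ^ n"

definition width :: "nat \<Rightarrow> nat" where
  "width n = M * mesh n"

definition tube :: "nat \<Rightarrow> (int ^ 'n) set" where
  "tube n = {z. z $ b mod int (mesh (Suc n)) < int (width n)}"

text \<open>Where tubes of several scales meet, the finest one decides. All directions other than \<open>a\<close> and \<open>b\<close>
are ignored: a tube is a neighbourhood of a hyperplane, which is as good as a neighbourhood of a
line for comparing the numbers of points in neighbouring cubes.\<close>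

definition pattern :: "(int ^ 'n) set" where
  "pattern = {z. \<exists>n<m. z \<in> tube n \<and> (\<forall>l<n. z \<notin> tube l) \<and> even (z $ a div int (width n))}"

lemma mesh_pos: "0 < mesh n" and width_pos: "0 < width n"
  using M_pos K_pos by (simp_all add: mesh_def width_def)

lemma mesh_Suc: "mesh (Suc n) = K * width n"
  by (simp add: mesh_def width_def)

lemma mesh_dvd: "i \<le> n \<Longrightarrow> mesh i dvd mesh n"
  by (simp add: mesh_def le_imp_power_dvd)

lemma width_mono: "i \<le> n \<Longrightarrow> width i \<le> width n"
  unfolding width_def by (intro mult_le_mono2 dvd_imp_le[OF mesh_dvd] mesh_pos)

lemma width_le_mesh: "width n \<le> mesh (Suc n)"
  using K_pos by (simp add: mesh_Suc)

text \<open>The edges of the cube are multiples of the period of the finer tubes, so the cube contains a whole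
number of periods.\<close>

lemma card_cube_tube:
  assumes "l < n" "int (mesh n) dvd c $ b"
  shows "K * card (cube c (int (width n)) \<inter> tube l) \<le> width n ^ CARD('n)"
proof -
  define h where "h = M * (M * K) ^ (n - Suc l)"
  have N: "(M * K) ^ n = (M * K) ^ (n - Suc l) * (M * K) ^ Suc l"
    using \<open>l < n\<close> by (simp add: power_add[symmetric] del: power_Suc)
  then have h: "width n = h * mesh (Suc l)"
    by (simp add: h_def width_def mesh_def)
  have hK: "K * (h * width l) = width n"
    unfolding h by (simp add: mesh_Suc)
  have dvd: "int (mesh (Suc l)) dvd c $ b"
    using assms mesh_dvd[of "Suc l" n] by (meson Suc_leI dvd_trans int_dvd_int_iff)
  have "cube c (int (width n)) \<inter> tube l
      = {z \<in> cube c (int (width n)). z $ b \<in> {t. t mod int (mesh (Suc l)) < int (width l)}}"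
    by (auto simp: tube_def)
  then have "card (cube c (int (width n)) \<inter> tube l)
      = card ({t. t mod int (mesh (Suc l)) < int (width l)} \<inter> {c $ b..<c $ b + int (h * mesh (Suc l))})
        * width n ^ (CARD('n) - 1)"
    by (simp only: card_cube_slab h[symmetric] nat_int)
  also have "\<dots> \<le> (h * width l) * width n ^ (CARD('n) - 1)"
    by (intro mult_le_mono1 card_residues_in_interval dvd mesh_pos)
  finally have "K * card (cube c (int (width n)) \<inter> tube l)
      \<le> K * ((h * width l) * width n ^ (CARD('n) - 1))"
    by (rule mult_le_mono2)
  also have "\<dots> = width n * width n ^ (CARD('n) - 1)"
    by (simp add: hK[symmetric] mult.assoc)
  also have "\<dots> = width n ^ CARD('n)"
    by (simp add: power_eq_if)
  finally show ?thesis .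
qed

lemma card_cube_finer_tubes:
  assumes "int (mesh n) dvd c $ b"
  shows "K * card (cube c (int (width n)) \<inter> (\<Union>l<n. tube l)) \<le> n * width n ^ CARD('n)"
proof -
  have "card (cube c (int (width n)) \<inter> (\<Union>l<n. tube l))
      = card (\<Union>l<n. cube c (int (width n)) \<inter> tube l)"
    by (rule arg_cong[where f = card]) blast
  also have "\<dots> \<le> (\<Sum>l<n. card (cube c (int (width n)) \<inter> tube l))"
    by (intro card_UN_le) simp
  finally have "K * card (cube c (int (width n)) \<inter> (\<Union>l<n. tube l))
      \<le> (\<Sum>l<n. K * card (cube c (int (width n)) \<inter> tube l))"
    by (simp add: sum_distrib_left[symmetric])
  also have "\<dots> \<le> (\<Sum>l<n. width n ^ CARD('n))"
    by (intro sum_mono card_cube_tube assms) simp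
  finally show ?thesis by simp
qed

lemma
  assumes z: "z \<in> cube c (int (width n))"
    and cb: "int (mesh (Suc n)) dvd c $ b" and ca: "c $ a = int (width n) * j"
  shows cube_subset_tube: "z \<in> tube n"
    and cube_div_width: "z $ a div int (width n) = j"
proof -
  have zb: "z $ b \<in> {c $ b..<c $ b + int (width n)}" and za: "z $ a \<in> {c $ a..<c $ a + int (width n)}"
    using z by (auto simp: cube_def)
  obtain q where q: "c $ b = int (mesh (Suc n)) * q" using cb by (elim dvdE)
  have "z $ b mod int (mesh (Suc n)) = (z $ b - c $ b) mod int (mesh (Suc n))"
    unfolding q by (metis mod_diff_right_eq mod_mult_self1_is_0 diff_zero)
  also have "\<dots> = z $ b - c $ b"
    using zb width_le_mesh[of n] by (intro mod_pos_pos_trivial) auto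
  finally show "z \<in> tube n" using zb by (simp add: tube_def)
  show "z $ a div int (width n) = j"
  proof (rule int_div_pos_eq)
    show "z $ a = int (width n) * j + (z $ a - c $ a)" using ca by linarith
  qed (use za in auto)
qed

lemma dense_cube:
  assumes "n < m" "int (mesh (Suc n)) dvd c $ b" "c $ a = int (width n) * j" "even j"
  shows "cube c (int (width n)) - (\<Union>l<n. tube l) \<subseteq> pattern"
proof
  fix z assume z: "z \<in> cube c (int (width n)) - (\<Union>l<n. tube l)"
  then have "z \<in> tube n" "z $ a div int (width n) = j"
    using cube_subset_tube[OF _ assms(2,3)] cube_div_width[OF _ assms(2,3)] by blast+
  then show "z \<in> pattern"
    using z assms(1,4) by (auto simp: pattern_def)
qed

lemma sparse_cube:
  assumes "int (mesh (Suc n)) dvd c $ b" "c $ a = int (width n) * j" "odd j"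
  shows "cube c (int (width n)) \<inter> pattern \<subseteq> (\<Union>l<n. tube l)"
proof
  fix z assume z: "z \<in> cube c (int (width n)) \<inter> pattern"
  then have "z \<in> tube n" "z $ a div int (width n) = j"
    using cube_subset_tube[OF _ assms(1,2)] cube_div_width[OF _ assms(1,2)] by blast+
  moreover obtain i where "i < m" "z \<in> tube i" "\<forall>l<i. z \<notin> tube l" "even (z $ a div int (width i))"
    using z by (auto simp: pattern_def)
  ultimately have "i < n"
    using \<open>odd j\<close> by (cases i n rule: linorder_cases) auto
  with \<open>z \<in> tube i\<close> show "z \<in> (\<Union>l<n. tube l)" by blast
qed

lemma card_finer_tubes_small:
  assumes "n < m" "int (mesh (Suc n)) dvd c $ b" "8 * m \<le> K"
  shows "8 * card (cube c (int (width n)) \<inter> (\<Union>l<n. tube l)) \<le> width n ^ CARD('n)"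
proof -
  let ?x = "card (cube c (int (width n)) \<inter> (\<Union>l<n. tube l))"
  have "int (mesh n) dvd c $ b"
    using assms(2) mesh_dvd[of n "Suc n"] by (meson dvd_trans int_dvd_int_iff le_SucI le_refl)
  then have "K * ?x \<le> n * width n ^ CARD('n)" by (rule card_cube_finer_tubes)
  also have "\<dots> \<le> m * width n ^ CARD('n)" using \<open>n < m\<close> by (intro mult_le_mono1) simp
  finally have upper: "K * ?x \<le> m * width n ^ CARD('n)" .
  have "m * (8 * ?x) = 8 * m * ?x" by simp
  also have "\<dots> \<le> K * ?x" using assms(3) by (rule mult_le_mono1)
  also note upper
  finally have "m * (8 * ?x) \<le> m * width n ^ CARD('n)" .
  then show ?thesis using \<open>n < m\<close> by (simp only: mult_le_cancel1)
qed

lemma card_dense_cube: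
  assumes "n < m" "int (mesh (Suc n)) dvd c $ b" "c $ a = int (width n) * j" "even j" "8 * m \<le> K"
  shows "7 / 8 * real (width n) ^ CARD('n) \<le> real (card (pattern \<inter> cube c (int (width n))))"
proof -
  let ?C = "cube c (int (width n))" and ?T = "\<Union>l<n. tube l"
  have small: "8 * card (?C \<inter> ?T) \<le> width n ^ CARD('n)"
    by (rule card_finer_tubes_small[OF assms(1,2,5)])
  have "width n ^ CARD('n) = card ?C" by (simp add: card_cube)
  also have "?C = (?C - ?T) \<union> (?C \<inter> ?T)" by auto
  also have "card \<dots> \<le> card (?C - ?T) + card (?C \<inter> ?T)" by (rule card_Un_le)
  also have "card (?C - ?T) \<le> card (pattern \<inter> ?C)"
    using dense_cube[OF assms(1-4)] by (intro card_mono) (simp, blast)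
  finally have "width n ^ CARD('n) \<le> card (pattern \<inter> ?C) + card (?C \<inter> ?T)" by simp
  with small have "7 * width n ^ CARD('n) \<le> 8 * card (pattern \<inter> ?C)" by simp
  then have "real (7 * width n ^ CARD('n)) \<le> real (8 * card (pattern \<inter> ?C))" by (simp only: of_nat_le_iff)
  then show ?thesis by simp
qed

lemma card_sparse_cube:
  assumes "n < m" "int (mesh (Suc n)) dvd c $ b" "c $ a = int (width n) * j" "odd j" "8 * m \<le> K"
  shows "real (card (pattern \<inter> cube c (int (width n)))) \<le> 1 / 8 * real (width n) ^ CARD('n)"
proof -
  let ?C = "cube c (int (width n))" and ?T = "\<Union>l<n. tube l"
  have "8 * card (?C \<inter> ?T) \<le> width n ^ CARD('n)"
    by (rule card_finer_tubes_small[OF assms(1,2,5)])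
  moreover have "card (pattern \<inter> ?C) \<le> card (?C \<inter> ?T)"
    using sparse_cube[OF assms(2-4)] by (intro card_mono) (simp, blast)
  ultimately have "8 * card (pattern \<inter> ?C) \<le> width n ^ CARD('n)" by simp
  then have "real (8 * card (pattern \<inter> ?C)) \<le> real (width n ^ CARD('n))" by (simp only: of_nat_le_iff)
  then show ?thesis by simp
qed

end

section \<open>The gain of stretch\<close>

text \<open>A map \<open>f\<close> that compares the enriched lattice with the lattice. It cannot exist if \<open>(1 + k) ^ m\<close> exceeds
the square of \<open>L\<close>, as \<open>stretch_bounded\<close> shows below. The constants are chosen in the order \<open>B\<close>, \<open>t\<close>, \<open>M\<close>, \<open>k\<close>, \<open>m\<close>,
\<open>K\<close>, \<open>r\<close>. Thickening a cube by the fraction \<open>1 / B\<close> of its side multiplies its volume by at most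
\<open>5 / 4\<close>; the margin of this thickening is \<open>t\<close> mesh widths on either side, which explains
\<open>M = 2 * B * t\<close>, and the bound on \<open>t\<close> lets it absorb all errors made below. The number \<open>k\<close> is the
gain in stretch from one scale to the next. It is so small that, if no step of a chain is longer than
\<open>1 + k\<close> times the mean, there are parallel steps in all chains whose images agree up to the
fraction \<open>1 / (4 * B * L)\<close> of their width.
The radius \<open>r\<close> leaves room for everything that is ever looked at.\<close>

locale bilipschitz_pattern = nested_tubes a b M K m
  for a b :: "'n::finite" and M K m :: nat +
  fixes L k r :: real and B t :: nat and f :: "real ^ 'n \<Rightarrow> real ^ 'n" and D :: "(real ^ 'n) set"
  assumes L_ge_1: "1 \<le> L"
    and B_pos: "0 < B" and B_large: "(1 + 1 / B) ^ CARD('n) \<le> (5 / 4 :: real)"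
    and M_eq: "M = 2 * B * t"
    and t_large: "2 * (L\<^sup>2 * CARD('n) + CARD('n) + 1) \<le> t"
    and k_pos: "0 < k" and k_le_1: "k \<le> 1"
    and k_small: "64 * L\<^sup>2 * real (M ^ CARD('n)) * k \<le> (1 / (4 * B * L))\<^sup>2"
    and K_even: "even K" and K_ge_m: "8 * m \<le> K" and K_large: "2 * CARD('n) \<le> k * K"
    and r_large: "2 * L\<^sup>2 * CARD('n) * (2 * (m + 2) * width m + 1) \<le> r"
    and D_eq: "D = enriched pattern UNIV \<inter> cball 0 r"
    and lipschitz: "\<And>x y. x \<in> D \<Longrightarrow> y \<in> D \<Longrightarrow> dist (f x) (f y) \<le> L * dist x y"
    and inverse_lipschitz: "\<And>x y. x \<in> D \<Longrightarrow> y \<in> D \<Longrightarrow> dist x y \<le> L * dist (f x) (f y)"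
    and image_lattice: "f ` D \<subseteq> range emb"
    and covers: "\<And>y. y \<in> range emb \<Longrightarrow> dist y (f 0) \<le> r / L \<Longrightarrow> y \<in> f ` D"
begin

definition box :: "(int ^ 'n) set" where
  "box = {z. \<forall>i. 0 \<le> z $ i \<and> z $ i \<le> int (2 * (m + 2) * width m)}"

lemma norm_enriched_box:
  assumes "p \<in> enriched pattern box"
  shows "norm p \<le> r / (2 * L\<^sup>2)"
proof -
  have "norm p \<le> CARD('n) * (real (2 * (m + 2) * width m) + 1)"
  proof (rule norm_le_card_mult)
    fix i
    from assms obtain z where z: "z \<in> box" "p = emb z \<or> p = emb z + half"
      by (auto simp: enriched_def)
    then have "0 \<le> z $ i" "z $ i \<le> int (2 * (m + 2) * width m)" by (auto simp: box_def)
    then have "0 \<le> real_of_int (z $ i)" "real_of_int (z $ i) \<le> real (2 * (m + 2) * width m)"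
      by linarith+
    moreover have "p $ i = real_of_int (z $ i) \<or> p $ i = real_of_int (z $ i) + 1 / 2"
      using z(2) by auto
    ultimately show "\<bar>p $ i\<bar> \<le> real (2 * (m + 2) * width m) + 1" by linarith
  qed
  also have "\<dots> \<le> r / (2 * L\<^sup>2)"
    using r_large L_ge_1 by (simp add: field_simps)
  finally show ?thesis .
qed

lemma enriched_box_subset: "enriched pattern box \<subseteq> D"
proof
  fix p assume p: "p \<in> enriched pattern box"
  have "0 \<le> r / (2 * L\<^sup>2)" using norm_enriched_box[OF p] norm_ge_zero[of p] by linarith
  then have "0 \<le> r" using L_ge_1 by (simp add: zero_le_divide_iff)
  have "1 \<le> L\<^sup>2" using L_ge_1 by (simp add: one_le_power)
  then have "1 \<le> 2 * L\<^sup>2" by linarith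
  then have "r / (2 * L\<^sup>2) \<le> r / 1"
    using \<open>0 \<le> r\<close> by (intro divide_left_mono) auto
  with norm_enriched_box[OF p] have "norm p \<le> r" by simp
  with p show "p \<in> D" by (auto simp: D_eq enriched_def)
qed

lemma emb_in_D: "z \<in> box \<Longrightarrow> emb z \<in> D"
  using enriched_box_subset by (auto simp: enriched_def)

lemma width_le: "real (width m) \<le> r / (2 * L\<^sup>2)"
proof -
  have "1 * width m \<le> CARD('n) * (2 * (m + 2) * width m + 1)"
    by (rule mult_le_mono) (simp_all add: Suc_leI)
  then have "real (width m) \<le> real (CARD('n) * (2 * (m + 2) * width m + 1))"
    by (simp only: of_nat_le_iff mult_1)
  also have "\<dots> \<le> r / (2 * L\<^sup>2)"
    using r_large L_ge_1 by (simp add: field_simps)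
  finally show ?thesis .
qed

text \<open>A pair \<open>x\<close>, \<open>x + width n\<close> in direction \<open>a\<close> whose distance is magnified by \<open>\<alpha>\<close> at least. The
bound on the coordinates grows by two coarsest cubes per scale, since refining a pair moves it by at
most that much; it keeps the pair in \<open>box\<close>.\<close>

definition stretched_pair :: "nat \<Rightarrow> real \<Rightarrow> int ^ 'n \<Rightarrow> bool" where
  "stretched_pair n \<alpha> x \<longleftrightarrow>
     (\<forall>i. int (mesh n) dvd x $ i \<and> 0 \<le> x $ i \<and> x $ i \<le> int (2 * (m - n) * width m)) \<and>
     \<alpha> * width n \<le> norm (f (emb (x + axis a (int (width n)))) - f (emb x))"

definition offsets :: "nat \<Rightarrow> (int ^ 'n) set" where
  "offsets n = {q. \<forall>i. q $ i \<in> (*) (int (mesh n)) ` {0..<int M}}"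

lemma finite_offsets: "finite (offsets n)"
  unfolding offsets_def by (rule finite_vectors) simp

lemma card_offsets: "card (offsets n) = M ^ CARD('n)"
proof -
  have "card ((*) (int (mesh n)) ` {0..<int M}) = M"
    using mesh_pos[of n] by (subst card_image) (auto simp: inj_on_def)
  then show ?thesis
    unfolding offsets_def by (subst card_vectors) simp
qed

lemma offsetsD:
  assumes "q \<in> offsets n"
  shows "int (mesh n) dvd q $ i" "0 \<le> q $ i" "q $ i \<le> int (width n)"
proof -
  obtain u where u: "u \<in> {0..<int M}" "q $ i = int (mesh n) * u"
    using assms unfolding offsets_def by blast
  then show "int (mesh n) dvd q $ i" "0 \<le> q $ i" by auto
  have "int (mesh n) * u \<le> int (mesh n) * int M" using u by (intro mult_left_mono) auto
  with u show "q $ i \<le> int (width n)" by (simp add: width_def mult.commute)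
qed

lemma zero_in_offsets: "0 \<in> offsets n"
  using M_pos by (auto simp: offsets_def image_iff intro!: bexI[of _ 0])

lemma norm_emb_offset:
  assumes "q \<in> offsets n"
  shows "norm (emb q) \<le> CARD('n) * real (width n)"
proof (rule norm_le_card_mult)
  fix i
  show "\<bar>emb q $ i\<bar> \<le> real (width n)"
    using offsetsD(2,3)[OF assms, of i] unfolding emb_component by linarith
qed

lemma width_Suc: "width (Suc n) = M * K * width n"
  by (simp add: width_def mesh_def)

lemma chain_in_box:
  assumes "n < m" "stretched_pair (Suc n) \<alpha> x" "i \<le> M * K" "q \<in> offsets n"
  shows "\<And>c. int (mesh n) dvd (x + q + axis a (int (i * width n))) $ c"
    "\<And>c. 0 \<le> (x + q + axis a (int (i * width n))) $ c"
    "\<And>c. (x + q + axis a (int (i * width n))) $ c \<le> int (2 * (m - n) * width m)"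
    "x + q + axis a (int (i * width n)) \<in> box"
proof -
  fix c
  have x: "int (mesh (Suc n)) dvd x $ c" "0 \<le> x $ c" "x $ c \<le> int (2 * (m - Suc n) * width m)" for c
    using assms(2) by (auto simp: stretched_pair_def)
  have "int (mesh n) dvd x $ c" for c
    using x(1) mesh_dvd[of n "Suc n"] by (meson dvd_trans int_dvd_int_iff le_SucI le_refl)
  moreover have "int (mesh n) dvd axis a (int (i * width n)) $ c"
    by (simp add: axis_nth width_def)
  ultimately show "int (mesh n) dvd (x + q + axis a (int (i * width n))) $ c"
    using offsetsD[OF assms(4)] by simp
  have ax: "0 \<le> axis a (int (i * width n)) $ c" "axis a (int (i * width n)) $ c \<le> int (i * width n)" for c
    by (simp_all add: axis_nth)
  show nonneg: "0 \<le> (x + q + axis a (int (i * width n))) $ c" for c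
    using x(2)[of c] ax(1)[of c] offsetsD(2)[OF assms(4), of c] by simp
  have q: "q $ c \<le> int (width m)" for c
    using offsetsD(3)[OF assms(4), of c] width_mono[of n m] assms(1) by linarith
  have *: "i * width n \<le> width m"
  proof -
    have "i * width n \<le> width (Suc n)" unfolding width_Suc using assms(3) by (rule mult_le_mono1)
    also have "\<dots> \<le> width m" using assms(1) by (intro width_mono) simp
    finally show ?thesis .
  qed
  have "m - n = Suc (m - Suc n)" using assms(1) by simp
  then have mn: "2 * (m - Suc n) * width m + width m + width m = 2 * (m - n) * width m"
    by (simp only:) simp
  have upper: "(x + q + axis a (int (i * width n))) $ c \<le> int (2 * (m - n) * width m)" for c
  proof -
    have "int (i * width n) \<le> int (width m)" using * by (simp only: of_nat_le_iff)
    then show ?thesis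
      unfolding mn[symmetric] of_nat_add vector_add_component
      using x(3)[of c] q[of c] ax(2)[of c] by linarith
  qed
  then show "(x + q + axis a (int (i * width n))) $ c \<le> int (2 * (m - n) * width m)" .
  have "2 * (m - n) * width m \<le> 2 * (m + 2) * width m" by (intro mult_le_mono) auto
  then have "int (2 * (m - n) * width m) \<le> int (2 * (m + 2) * width m)" by (simp only: of_nat_le_iff)
  then have "(x + q + axis a (int (i * width n))) $ c \<le> int (2 * (m + 2) * width m)" for c
    using upper[of c] by linarith
  then show "x + q + axis a (int (i * width n)) \<in> box"
    unfolding box_def mem_Collect_eq using nonneg by blast
qed

lemma stretch_le_lipschitz:
  assumes "n \<le> m" "stretched_pair n \<alpha> x"
  shows "\<alpha> \<le> L"
proof -
  have "2 * (m - n) * width m + width n \<le> 2 * (m + 2) * width m"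
    using width_mono[OF assms(1)] mult_le_mono1[of "2 * (m - n) + 1" "2 * (m + 2)" "width m"]
    by (simp add: algebra_simps)
  then have le: "int (2 * (m - n) * width m) + int (width n) \<le> int (2 * (m + 2) * width m)"
    by linarith
  have x: "0 \<le> x $ c" "x $ c \<le> int (2 * (m - n) * width m)" for c
    using assms(2) by (auto simp: stretched_pair_def)
  have "x \<in> box" "x + axis a (int (width n)) \<in> box"
  proof -
    have "0 \<le> x $ c \<and> x $ c \<le> int (2 * (m + 2) * width m)" for c
      using x[of c] le by linarith
    moreover have "0 \<le> (x + axis a (int (width n))) $ c \<and> (x + axis a (int (width n))) $ c \<le> int (2 * (m + 2) * width m)" for c
      unfolding vector_add_component axis_nth using x[of c] le by (smt (verit) of_nat_0_le_iff)
    ultimately show "x \<in> box" "x + axis a (int (width n)) \<in> box"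
      unfolding box_def by blast+
  qed
  then have "dist (f (emb (x + axis a (int (width n))))) (f (emb x))
      \<le> L * dist (emb (x + axis a (int (width n)))) (emb x)"
    by (intro lipschitz emb_in_D)
  also have "dist (emb (x + axis a (int (width n)))) (emb x) = width n"
    by (simp add: dist_norm emb_add emb_axis norm_axis_of_nat)
  finally have "\<alpha> * width n \<le> L * width n"
    using assms(2) by (simp add: stretched_pair_def dist_norm)
  then show ?thesis using width_pos[of n] by simp
qed

text \<open>Cut the stretched pair into a chain of \<open>M * K\<close> steps of the next finer width, and consider all
translates of this chain by \<open>offsets\<close>. By the triangle inequality the images of the steps have mean
projection about \<open>\<alpha> * width n\<close> to the direction of the image of the pair. If no step is
stretched by more than \<open>(1 + k) * \<alpha>\<close>, this mean is almost the maximum, so most steps are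
close to one and the same vector. There are only \<open>M ^ CARD('n)\<close> chains, a number that is fixed
before \<open>k\<close>, so by the pigeonhole principle one even position works for all chains simultaneously.\<close>

lemma almost_constant_steps:
  assumes "n < m" and x: "stretched_pair (Suc n) \<alpha> x" and "0 < \<alpha>"
    and no_gain: "\<And>y. \<not> stretched_pair n ((1 + k) * \<alpha>) y"
  obtains j where "2 * j + 1 < M * K"
    "\<And>q. q \<in> offsets n \<Longrightarrow>
      norm ((f (emb (x + q + axis a (int ((2 * j + 1) * width n))))
            - f (emb (x + q + axis a (int (2 * j * width n)))))
          - (f (emb (x + axis a (int ((2 * j + 1) * width n))))
            - f (emb (x + axis a (int (2 * j * width n))))))
        \<le> width n / (4 * B * L)"
proof -
  define s where "s = real (width n)"
  define N where "N = M * K"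
  define h where "h = M * (K div 2)"
  have Nh: "N = 2 * h" using K_even by (simp add: N_def h_def)
  have "0 < N" using M_pos K_pos by (simp add: N_def)
  then have "0 < h" using Nh by simp
  define P where "P q i = f (emb (x + q + axis a (int (i * width n))))" for q i
  define u where "u q i = P q (Suc i) - P q i" for q i
  have in_D: "emb (x + q + axis a (int (i * width n))) \<in> D" if "q \<in> offsets n" "i \<le> N" for q i
    using emb_in_D chain_in_box(4)[OF assms(1) x] that by (simp add: N_def)
  define U where "U = (1 + k) * \<alpha> * s"
  have "s > 0" using width_pos by (simp add: s_def)
  have "\<alpha> \<le> L" using stretch_le_lipschitz[OF _ x] assms(1) by simp
  have "U > 0" using k_pos \<open>0 < \<alpha>\<close> \<open>0 < s\<close> by (simp add: U_def)
  have U_le: "U \<le> 2 * L * s"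
    unfolding U_def using k_pos k_le_1 \<open>\<alpha> \<le> L\<close> \<open>0 < \<alpha>\<close> \<open>0 < s\<close> by (intro mult_right_mono mult_mono) auto
  have u_le: "norm (u q i) \<le> U" if "q \<in> offsets n" "i < N" for q i
  proof (rule ccontr)
    assume "\<not> norm (u q i) \<le> U"
    moreover have "x + q + axis a (int (i * width n)) + axis a (int (width n))
        = x + q + axis a (int (Suc i * width n))"
      by (simp add: vec_eq_iff axis_nth)
    ultimately have "(1 + k) * \<alpha> * width n
        \<le> norm (f (emb (x + q + axis a (int (i * width n)) + axis a (int (width n))))
            - f (emb (x + q + axis a (int (i * width n)))))"
      by (simp only: u_def P_def U_def s_def)
    then have "stretched_pair n ((1 + k) * \<alpha>) (x + q + axis a (int (i * width n)))"
      using chain_in_box(1-3)[OF assms(1) x less_imp_le that(1), of i] that(2)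
      by (simp only: stretched_pair_def N_def) auto
    with no_gain show False by blast
  qed
  define V where "V = norm (P 0 N - P 0 0)"
  have "\<alpha> * (real N * s) \<le> V"
    using x by (simp add: stretched_pair_def V_def P_def N_def s_def width_Suc mult_ac axis_def zero_vec_def[symmetric])
  moreover have "0 < \<alpha> * (real N * s)" using \<open>0 < \<alpha>\<close> \<open>0 < N\<close> \<open>0 < s\<close> by simp
  ultimately have "0 < V" by linarith
  \<comment> \<open>the direction in which the image of the pair points\<close>
  define e where "e = (1 / V) *\<^sub>R (P 0 N - P 0 0)"
  have "norm e = 1" using \<open>0 < V\<close> by (simp add: e_def V_def)
  have Ve: "(P 0 N - P 0 0) \<bullet> e = V"
    using \<open>0 < V\<close> by (simp add: e_def V_def dot_square_norm power2_eq_square)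
  have inner_le: "v \<bullet> e \<le> norm v" for v
    using norm_cauchy_schwarz[of v e] \<open>norm e = 1\<close> by simp
  \<comment> \<open>a translated chain has its image close to that of the original one\<close>
  have drift: "norm (P 0 i - P q i) \<le> L * (CARD('n) * s)" if "q \<in> offsets n" "i \<le> N" for q i
  proof -
    have "dist (P 0 i) (P q i) \<le> L * dist (emb (x + 0 + axis a (int (i * width n)))) (emb (x + q + axis a (int (i * width n))))"
      unfolding P_def by (intro lipschitz in_D that zero_in_offsets)
    also have "dist (emb (x + 0 + axis a (int (i * width n)))) (emb (x + q + axis a (int (i * width n)))) = norm (emb q)"
      by (simp add: dist_norm emb_add)
    also have "L * norm (emb q) \<le> L * (CARD('n) * s)"
      using norm_emb_offset[OF that(1)] L_ge_1 by (intro mult_left_mono) (auto simp: s_def)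
    finally show ?thesis by (simp add: dist_norm)
  qed
  have sum_le: "(\<Sum>i<2 * h. U - u q i \<bullet> e) \<le> real (2 * h) * (2 * k * L * s)" if "q \<in> offsets n" for q
  proof -
    have "(\<Sum>i<N. u q i) = P q N - P q 0"
      unfolding u_def by (rule sum_lessThan_telescope)
    then have "(\<Sum>i<N. u q i \<bullet> e) = (P q N - P q 0) \<bullet> e"
      by (simp add: inner_sum_left[symmetric])
    also have "\<dots> = V - (P 0 N - P q N) \<bullet> e - (P q 0 - P 0 0) \<bullet> e"
      unfolding Ve[symmetric] by (simp add: inner_diff_left)
    also have "\<dots> \<ge> V - L * (CARD('n) * s) - L * (CARD('n) * s)"
      using inner_le[of "P 0 N - P q N"] inner_le[of "P q 0 - P 0 0"] drift[OF that, of N] drift[OF that, of 0]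
        norm_minus_commute[of "P q 0" "P 0 0"] by linarith
    finally have "(\<Sum>i<N. u q i \<bullet> e) \<ge> \<alpha> * (real N * s) - 2 * L * CARD('n) * s"
      using \<open>\<alpha> * (real N * s) \<le> V\<close> by (simp add: mult_ac)
    moreover have "(\<Sum>i<N. U - u q i \<bullet> e) = real N * U - (\<Sum>i<N. u q i \<bullet> e)"
      by (simp add: sum_subtractf)
    moreover have "real N * U = \<alpha> * (real N * s) + k * \<alpha> * (real N * s)"
      by (simp add: U_def algebra_simps)
    moreover have "k * \<alpha> * (real N * s) \<le> k * L * (real N * s)"
      using k_pos \<open>\<alpha> \<le> L\<close> \<open>0 < s\<close> by (intro mult_right_mono mult_left_mono) auto
    moreover have "2 * L * CARD('n) * s \<le> k * L * (real N * s)"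
    proof -
      have "1 * K \<le> N" unfolding N_def using M_pos by (intro mult_le_mono1) simp
      then have "real K \<le> real N" by simp
      then have "k * K \<le> k * N" using k_pos by (intro mult_left_mono) auto
      with K_large have "2 * CARD('n) \<le> k * N" by linarith
      then have "(L * s) * (2 * CARD('n)) \<le> (L * s) * (k * N)"
        using L_ge_1 \<open>0 < s\<close> by (intro mult_left_mono) auto
      then show ?thesis by (simp add: mult_ac)
    qed
    ultimately have "(\<Sum>i<N. U - u q i \<bullet> e) \<le> 2 * (k * L * (real N * s))" by linarith
    then show ?thesis by (simp add: Nh mult_ac)
  qed
  have nonneg: "0 \<le> U - u q i \<bullet> e" if "q \<in> offsets n" "i < 2 * h" for q i
    using inner_le[of "u q i"] u_le[of q i] that by (simp add: Nh)
  obtain j where "j < h"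
    and proj: "\<And>q. q \<in> offsets n \<Longrightarrow> U - u q (2 * j) \<bullet> e \<le> 2 * real (card (offsets n)) * (2 * k * L * s)"
    using pigeonhole_even[where \<delta> = "\<lambda>q i. U - u q i \<bullet> e", OF finite_offsets \<open>0 < h\<close> nonneg sum_le] by blast
  have close: "norm (u q (2 * j) - U *\<^sub>R e) \<le> s / (4 * B * L) / 2" if "q \<in> offsets n" for q
  proof -
    let ?\<eta> = "2 * real (card (offsets n)) * (2 * k * L * s)"
    have "0 \<le> ?\<eta>" using k_pos L_ge_1 \<open>0 < s\<close> by simp
    have "(norm (u q (2 * j) - U *\<^sub>R e))\<^sup>2 \<le> 2 * U * ?\<eta>"
    proof (rule near_maximal_projection)
      show "norm (u q (2 * j)) \<le> U" using u_le[OF that] \<open>j < h\<close> Nh by simp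
      show "U - ?\<eta> \<le> u q (2 * j) \<bullet> e" using proj[OF that] by linarith
    qed (use \<open>norm e = 1\<close> \<open>0 < U\<close> in auto)
    also have "\<dots> \<le> 2 * (2 * L * s) * ?\<eta>"
      using U_le \<open>0 \<le> ?\<eta>\<close> by (intro mult_right_mono mult_left_mono) auto
    also have "\<dots> = (64 * L\<^sup>2 * real (M ^ CARD('n)) * k) * (s / 2)\<^sup>2"
      by (simp add: card_offsets power2_eq_square)
    also have "\<dots> \<le> (1 / (4 * B * L))\<^sup>2 * (s / 2)\<^sup>2"
      using k_small by (intro mult_right_mono) auto
    also have "\<dots> = (s / (4 * B * L) / 2)\<^sup>2"
      by (simp add: power2_eq_square)
    finally show ?thesis
      using L_ge_1 \<open>0 < s\<close> by (auto intro!: power2_le_imp_le[of "norm (u q (2 * j) - U *\<^sub>R e)"])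
  qed
  show thesis
  proof (rule that)
    show "2 * j + 1 < M * K" using \<open>j < h\<close> Nh by (simp add: N_def)
    fix q assume q: "q \<in> offsets n"
    have "norm (u q (2 * j) - u 0 (2 * j)) \<le> norm (u q (2 * j) - U *\<^sub>R e) + norm (u 0 (2 * j) - U *\<^sub>R e)"
      using norm_triangle_ineq4[of "u q (2 * j) - U *\<^sub>R e" "u 0 (2 * j) - U *\<^sub>R e"] by simp
    also have "\<dots> \<le> s / (4 * B * L)"
      using close[OF q] close[OF zero_in_offsets] by linarith
    finally show "norm ((f (emb (x + q + axis a (int ((2 * j + 1) * width n))))
            - f (emb (x + q + axis a (int (2 * j * width n)))))
          - (f (emb (x + axis a (int ((2 * j + 1) * width n))))
            - f (emb (x + axis a (int (2 * j * width n))))))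
        \<le> width n / (4 * B * L)"
      by (simp only: u_def P_def s_def add_0_right Suc_eq_plus1)
  qed
qed

text \<open>If the steps from a dense cube to the next cube have almost constant images, then \<open>f\<close> moved by
their common value \<open>w\<close> is nearly \<open>f\<close> on the neighbouring cube. The vector \<open>w\<close> is a difference of
two lattice points, so \<open>f p + w\<close> is again a lattice point and has a preimage, which can only lie in
a small neighbourhood of the neighbouring cube. This takes the place of comparing the volumes of the
images of the two cubes.\<close>

lemma translated_preimage:
  assumes "n < m" and x: "stretched_pair (Suc n) \<alpha> x" and j: "2 * j + 1 < M * K"
    and const: "\<forall>q\<in>offsets n.
      norm ((f (emb (x + q + axis a (int ((2 * j + 1) * width n))))
            - f (emb (x + q + axis a (int (2 * j * width n)))))
          - (f (emb (x + axis a (int ((2 * j + 1) * width n))))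
            - f (emb (x + axis a (int (2 * j * width n))))))
        \<le> width n / (4 * B * L)"
    and p: "p \<in> enriched pattern (cube (x + axis a (int (2 * j * width n))) (int (width n)))"
  shows "p \<in> D"
    and "\<exists>p'\<in>enriched pattern
          (cube (\<chi> i. (x + axis a (int ((2 * j + 1) * width n))) $ i - int (t * mesh n))
                (int (width n + 2 * (t * mesh n)))).
           p' \<in> D \<and> f p' = f p
             + (f (emb (x + axis a (int ((2 * j + 1) * width n))))
               - f (emb (x + axis a (int (2 * j * width n)))))"
proof -
  define s where "s = real (width n)"
  define \<tau> where "\<tau> = real (mesh n)"
  define c where "c = x + axis a (int (2 * j * width n))"
  define c' where "c' = x + axis a (int ((2 * j + 1) * width n))"
  define w where "w = f (emb c') - f (emb c)"
  have "1 \<le> \<tau>" using mesh_pos[of n] by (simp add: \<tau>_def)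
  have "real M = 2 * B * t" by (simp add: M_eq)
  then have s_eq: "s = 2 * B * t * \<tau>" by (simp add: s_def \<tau>_def width_def)
  have c'_eq: "c' = c + axis a (int (width n))"
    by (simp add: c_def c'_def vec_eq_iff axis_nth algebra_simps)
  obtain z where z: "z \<in> cube c (int (width n))" and pz: "p = emb z \<or> p = emb z + half \<and> z \<in> pattern"
    using p by (auto simp: enriched_def c_def)
  have zc: "c $ i \<le> z $ i" "z $ i < c $ i + int (width n)" for i
    using z by (auto simp: cube_def)
  have c_box: "c + q \<in> box" "c' + q \<in> box" if "q \<in> offsets n" for q
    using chain_in_box(4)[OF assms(1) x _ that, of "2 * j"] chain_in_box(4)[OF assms(1) x _ that, of "2 * j + 1"] j
    by (simp_all add: c_def c'_def ac_simps)
  have "z \<in> box"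
  proof -
    have "0 \<le> z $ i \<and> z $ i \<le> int (2 * (m + 2) * width m)" for i
    proof -
      have x: "x $ i \<ge> 0" "x $ i \<le> int (2 * (m - Suc n) * width m)" using x by (auto simp: stretched_pair_def)
      have "(2 * j + 1) * width n \<le> width (Suc n)"
        unfolding width_Suc using j by (intro mult_le_mono1) simp
      also have "\<dots> \<le> width m" using \<open>n < m\<close> by (intro width_mono) simp
      finally have "2 * (m - Suc n) * width m + (2 * j + 1) * width n \<le> 2 * m * width m + width m"
        by (intro add_mono mult_le_mono) auto
      then have "int (2 * (m - Suc n) * width m) + int (2 * j * width n) + int (width n) \<le> int (2 * (m + 2) * width m)"
        unfolding of_nat_add[symmetric] of_nat_le_iff by (simp add: algebra_simps)
      moreover have "c $ i = x $ i + (if i = a then int (2 * j * width n) else 0)"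
        by (simp add: c_def axis_nth)
      ultimately show ?thesis using zc[of i] x by (smt (verit) of_nat_0_le_iff)
    qed
    then show ?thesis by (simp add: box_def)
  qed
  then have p_box: "p \<in> enriched pattern box"
    using pz by (auto simp: enriched_def)
  then show "p \<in> D" using enriched_box_subset by blast

  \<comment> \<open>the mesh point below \<open>p\<close>\<close>
  define q :: "int ^ 'n" where "q = (\<chi> i. int (mesh n) * ((z $ i - c $ i) div int (mesh n)))"
  have q: "q \<in> offsets n"
  proof -
    have "(z $ i - c $ i) div int (mesh n) \<in> {0..<int M}" for i
    proof -
      have "z $ i - c $ i < int (mesh n) * int M" using zc[of i] by (simp add: width_def mult.commute)
      then have "(z $ i - c $ i) div int (mesh n) < int M" using mesh_pos[of n] by (intro int_div_pos_less) auto
      moreover have "0 \<le> (z $ i - c $ i) div int (mesh n)"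
        using zc[of i] mesh_pos[of n] by (intro pos_imp_zdiv_nonneg_iff[THEN iffD2]) auto
      ultimately show ?thesis by simp
    qed
    then show ?thesis by (auto simp: offsets_def q_def)
  qed
  define g where "g = emb (c + q)"
  define g' where "g' = emb (c' + q)"
  have gD: "g \<in> D" "g' \<in> D" using c_box[OF q] emb_in_D by (auto simp: g_def g'_def)
  have pg: "dist p g \<le> CARD('n) * \<tau>"
    unfolding dist_norm
  proof (rule norm_le_card_mult)
    fix i
    have "z $ i - (c + q) $ i = (z $ i - c $ i) mod int (mesh n)"
      using minus_mult_div_eq_mod[of "z $ i - c $ i" "int (mesh n)"]
      unfolding q_def vector_add_component vec_lambda_beta by linarith
    moreover have "0 \<le> (z $ i - c $ i) mod int (mesh n)" "(z $ i - c $ i) mod int (mesh n) < int (mesh n)"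
      using mesh_pos[of n] by auto
    ultimately have "0 \<le> z $ i - (c + q) $ i" "z $ i - (c + q) $ i \<le> int (mesh n) - 1" by linarith+
    then have "0 \<le> real_of_int (z $ i) - real_of_int ((c + q) $ i)"
        "real_of_int (z $ i) - real_of_int ((c + q) $ i) \<le> \<tau> - 1"
      unfolding \<tau>_def by linarith+
    moreover have "(p - g) $ i = real_of_int (z $ i) - real_of_int ((c + q) $ i)
        \<or> (p - g) $ i = real_of_int (z $ i) - real_of_int ((c + q) $ i) + 1 / 2"
      using pz by (auto simp: g_def)
    ultimately show "\<bar>(p - g) $ i\<bar> \<le> \<tau>" by linarith
  qed
  have "0 \<in> offsets n" by (rule zero_in_offsets)
  then have cD: "emb c \<in> D" "emb c' \<in> D" using c_box[of 0] emb_in_D by auto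
  have w_step: "norm ((f g' - f g) - w) \<le> s / (4 * B * L)"
    using bspec[OF const q] by (simp add: g_def g'_def w_def c_def c'_def s_def ac_simps)

  \<comment> \<open>the lattice is closed under translation by \<open>w\<close>\<close>
  have "f p + w \<in> range emb"
  proof -
    have "f p \<in> range emb" "f (emb c) \<in> range emb" "f (emb c') \<in> range emb"
      using image_lattice \<open>p \<in> D\<close> cD by auto
    then obtain u1 u2 u3 where "f p = emb u1" "f (emb c) = emb u2" "f (emb c') = emb u3"
      by blast
    then have "f p + w = emb (u1 + (u3 - u2))" by (simp add: w_def emb_add emb_diff)
    then show ?thesis by blast
  qed
  moreover have "dist (f p + w) (f 0) \<le> r / L"
  proof -
    have "(0 :: int ^ 'n) \<in> box" by (simp add: box_def)
    then have "0 \<in> D" using emb_in_D[of 0] by simp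
    have "dist (f p + w) (f 0) \<le> norm (f p - f 0) + norm w"
      unfolding dist_norm by (metis add_diff_eq add.commute norm_triangle_ineq)
    also have "norm (f p - f 0) \<le> L * norm p"
      using lipschitz[OF \<open>p \<in> D\<close> \<open>0 \<in> D\<close>] by (simp add: dist_norm)
    also have "norm w \<le> L * s"
      using lipschitz[OF cD(2,1)] by (simp add: w_def dist_norm c'_eq emb_add emb_axis s_def norm_axis_of_nat)
    also have "L * norm p + L * s \<le> L * (r / (2 * L\<^sup>2)) + L * (r / (2 * L\<^sup>2))"
    proof -
      have "s \<le> r / (2 * L\<^sup>2)"
        using width_le width_mono[of n m] \<open>n < m\<close> unfolding s_def by linarith
      then show ?thesis
        using norm_enriched_box[OF p_box] L_ge_1 by (intro add_mono mult_left_mono) auto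
    qed
    also have "\<dots> = r / L" using L_ge_1 by (simp add: power2_eq_square field_simps)
    finally show ?thesis by simp
  qed
  ultimately obtain p' where p': "p' \<in> D" "f p' = f p + w"
    using covers by (metis imageE)

  have "dist (f p') (f g') \<le> L * (CARD('n) * \<tau>) + s / (4 * B * L)"
  proof -
    have "f p' - f g' = (f p - f g) - ((f g' - f g) - w)" by (simp add: p'(2))
    then have "dist (f p') (f g') \<le> norm (f p - f g) + norm ((f g' - f g) - w)"
      unfolding dist_norm by (metis norm_triangle_ineq4)
    also have "norm (f p - f g) \<le> L * dist p g"
      using lipschitz[OF \<open>p \<in> D\<close> gD(1)] by (simp add: dist_norm)
    also have "L * dist p g \<le> L * (CARD('n) * \<tau>)"
      using pg L_ge_1 by (intro mult_left_mono) auto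
    finally show ?thesis using w_step by linarith
  qed
  then have "L * dist (f p') (f g') \<le> L * (L * (CARD('n) * \<tau>) + s / (4 * B * L))"
    using L_ge_1 by (intro mult_left_mono) auto
  then have "dist p' g' \<le> L * (L * (CARD('n) * \<tau>) + s / (4 * B * L))"
    using inverse_lipschitz[OF p'(1) gD(2)] by linarith
  also have "\<dots> = L\<^sup>2 * CARD('n) * \<tau> + t * \<tau> / 2"
    using L_ge_1 B_pos by (simp add: s_eq power2_eq_square field_simps)
  finally have p'g': "dist p' g' \<le> L\<^sup>2 * CARD('n) * \<tau> + t * \<tau> / 2" .
  \<comment> \<open>half of the margin pays for the variation of the steps, the other half for the mesh\<close>
  have total: "dist p' g' + dist p g + 1 \<le> t * \<tau>"
  proof -
    have "2 * (L\<^sup>2 * CARD('n) + CARD('n) + 1) * \<tau> \<le> t * \<tau>"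
      using t_large \<open>1 \<le> \<tau>\<close> by (intro mult_right_mono) auto
    then have "L\<^sup>2 * CARD('n) * \<tau> + CARD('n) * \<tau> + \<tau> \<le> t * \<tau> / 2"
      by (simp add: algebra_simps)
    then show ?thesis using p'g' pg \<open>1 \<le> \<tau>\<close> by linarith
  qed
  obtain z' where pz': "p' = emb z' \<or> p' = emb z' + half \<and> z' \<in> pattern"
    using p'(1) by (auto simp: D_eq enriched_def)
  have "z' $ i \<in> {c' $ i - int (t * mesh n)..<c' $ i - int (t * mesh n) + int (width n + 2 * (t * mesh n))}" for i
  proof -
    have "\<bar>(p' - g') $ i\<bar> \<le> dist p' g'" "\<bar>(p - g) $ i\<bar> \<le> dist p g"
      unfolding dist_norm by (rule component_le_norm_cart)+
    moreover have "g' $ i = g $ i + (real_of_int (c' $ i) - real_of_int (c $ i))"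
      by (simp add: g_def g'_def)
    ultimately have "\<bar>p' $ i - p $ i - (real_of_int (c' $ i) - real_of_int (c $ i))\<bar> \<le> t * \<tau> - 1"
      using total by simp
    moreover have "p $ i = real_of_int (z $ i) \<or> p $ i = real_of_int (z $ i) + 1 / 2"
      "p' $ i = real_of_int (z' $ i) \<or> p' $ i = real_of_int (z' $ i) + 1 / 2"
      using pz pz' by auto
    moreover have "real_of_int (c $ i) \<le> real_of_int (z $ i)"
      "real_of_int (z $ i) \<le> real_of_int (c $ i) + real_of_int (int (width n)) - 1"
      using zc[of i] by linarith+
    ultimately have "real_of_int (c' $ i) - t * \<tau> \<le> real_of_int (z' $ i)"
      "real_of_int (z' $ i) < real_of_int (c' $ i) + real_of_int (int (width n)) + t * \<tau>"
      by linarith+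
    moreover have "t * \<tau> = real_of_int (int (t * mesh n))" by (simp add: \<tau>_def)
    ultimately have "c' $ i - int (t * mesh n) \<le> z' $ i" "z' $ i < c' $ i + int (width n) + int (t * mesh n)"
      by linarith+
    then show ?thesis by simp
  qed
  then have "z' \<in> cube (\<chi> i. c' $ i - int (t * mesh n)) (int (width n + 2 * (t * mesh n)))"
    unfolding cube_def by simp
  then have "p' \<in> enriched pattern (cube (\<chi> i. c' $ i - int (t * mesh n)) (int (width n + 2 * (t * mesh n))))"
    using pz' by (auto simp: enriched_def)
  with p' show "\<exists>p'\<in>enriched pattern
          (cube (\<chi> i. (x + axis a (int ((2 * j + 1) * width n))) $ i - int (t * mesh n))
                (int (width n + 2 * (t * mesh n)))).
           p' \<in> D \<and> f p' = f p
             + (f (emb (x + axis a (int ((2 * j + 1) * width n))))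
               - f (emb (x + axis a (int (2 * j * width n)))))"
    unfolding w_def c_def c'_def by blast
qed

text \<open>Without a gain, \<open>translated_preimage\<close> injects the points of a dense cube into the slightly
thickened neighbouring cube, which is sparse. Measured in volumes of the cube, the former has at
least \<open>1 + 7/8\<close> points and the latter at most \<open>5/4 + (1/8 + 1/4)\<close>.\<close>

lemma stretch_gain:
  assumes "n < m" and x: "stretched_pair (Suc n) \<alpha> x" and "0 < \<alpha>"
  shows "\<exists>y. stretched_pair n ((1 + k) * \<alpha>) y"
proof (rule ccontr)
  assume "\<not> ?thesis"
  then have no_gain: "\<And>y. \<not> stretched_pair n ((1 + k) * \<alpha>) y" by blast
  from almost_constant_steps[OF assms no_gain] obtain j where j: "2 * j + 1 < M * K"
    and const: "\<forall>q\<in>offsets n.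
      norm ((f (emb (x + q + axis a (int ((2 * j + 1) * width n))))
            - f (emb (x + q + axis a (int (2 * j * width n)))))
          - (f (emb (x + axis a (int ((2 * j + 1) * width n))))
            - f (emb (x + axis a (int (2 * j * width n))))))
        \<le> width n / (4 * B * L)"
    by (metis (no_types, lifting))
  define c where "c = x + axis a (int (2 * j * width n))"
  define c' where "c' = x + axis a (int ((2 * j + 1) * width n))"
  define S where "S = cube c (int (width n))"
  define S' where "S' = cube c' (int (width n))"
  define T where "T = cube (\<chi> i. c' $ i - int (t * mesh n)) (int (width n + 2 * (t * mesh n)))"
  define V where "V = real (width n) ^ CARD('n)"
  have "0 < V" using width_pos[of n] by (simp add: V_def)
  note preimage = translated_preimage[OF assms(1) x j const, folded c_def c'_def, folded S_def T_def]
  have "\<forall>p\<in>enriched pattern S. \<exists>p'. p' \<in> enriched pattern T \<and> p' \<in> D \<and> f p' = f p + (f (emb c') - f (emb c))"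
    using preimage(2) by blast
  then obtain \<theta> where \<theta>: "\<And>p. p \<in> enriched pattern S \<Longrightarrow>
      \<theta> p \<in> enriched pattern T \<and> \<theta> p \<in> D \<and> f (\<theta> p) = f p + (f (emb c') - f (emb c))"
    by (metis (no_types))
  have "inj_on \<theta> (enriched pattern S)"
  proof (rule inj_onI)
    fix p1 p2 assume p: "p1 \<in> enriched pattern S" "p2 \<in> enriched pattern S" "\<theta> p1 = \<theta> p2"
    then have "f p1 = f p2" using \<theta>[OF p(1)] \<theta>[OF p(2)] by simp
    then have "dist p1 p2 \<le> 0"
      using inverse_lipschitz[OF preimage(1)[OF p(1)] preimage(1)[OF p(2)]] by simp
    then show "p1 = p2" by simp
  qed
  then have "card (enriched pattern S) \<le> card (enriched pattern T)"
    using \<theta> by (intro card_inj_on_le[where f = \<theta>]) (auto intro: finite_enriched simp: T_def)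
  then have count: "real (card S) + real (card (pattern \<inter> S)) \<le> real (card T) + real (card (pattern \<inter> T))"
    by (simp add: card_enriched S_def T_def del: of_nat_add flip: of_nat_add)

  have xa: "int (mesh (Suc n)) dvd x $ i" for i using x by (simp add: stretched_pair_def)
  obtain y where y: "x $ a = int (mesh (Suc n)) * y" using xa[of a] by (elim dvdE)
  have cb: "int (mesh (Suc n)) dvd c $ b" "int (mesh (Suc n)) dvd c' $ b"
    using xa[of b] coordinates_distinct by (simp_all add: c_def c'_def axis_nth)
  \<comment> \<open>\<open>K\<close> is even, so whether a cube is dense depends only on its position in the chain\<close>
  have ca: "c $ a = int (width n) * (int K * y + 2 * int j)"
    "c' $ a = int (width n) * (int K * y + 2 * int j + 1)"
    by (simp_all add: c_def c'_def axis_nth y mesh_Suc algebra_simps)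
  have dense: "7 / 8 * V \<le> real (card (pattern \<inter> S))"
    unfolding V_def S_def by (rule card_dense_cube[OF assms(1) cb(1) ca(1) _ K_ge_m]) (use K_even in simp)
  have sparse: "real (card (pattern \<inter> S')) \<le> 1 / 8 * V"
    unfolding V_def S'_def by (rule card_sparse_cube[OF assms(1) cb(2) ca(2) _ K_ge_m]) (use K_even in simp)
  have cards: "real (card S) = V" "real (card S') = V"
    by (simp_all add: S_def S'_def V_def card_cube)
  have T_card: "real (card T) \<le> 5 / 4 * V"
  proof -
    have "real M = 2 * B * t" by (simp add: M_eq)
    then have "real (width n + 2 * (t * mesh n)) = real (width n) * (1 + 1 / B)"
      using B_pos by (simp add: width_def field_simps)
    moreover have "real (card T) = real (width n + 2 * (t * mesh n)) ^ CARD('n)"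
      by (simp only: T_def card_cube nat_int of_nat_power)
    ultimately have "real (card T) = V * (1 + 1 / B) ^ CARD('n)"
      by (simp only: V_def power_mult_distrib)
    also have "\<dots> \<le> V * (5 / 4)"
      using B_large \<open>0 < V\<close> by (intro mult_left_mono) auto
    finally show ?thesis by simp
  qed
  have "S' \<subseteq> T"
  proof
    fix z assume "z \<in> S'"
    then have z: "c' $ i \<le> z $ i" "z $ i < c' $ i + int (width n)" for i
      by (auto simp: S'_def cube_def)
    have "c' $ i - int (t * mesh n) \<le> z $ i \<and> z $ i < c' $ i - int (t * mesh n) + int (width n + 2 * (t * mesh n))" for i
      using z[of i] by linarith
    then show "z \<in> T" by (simp add: T_def cube_def)
  qed
  have "card (pattern \<inter> T) \<le> card ((pattern \<inter> S') \<union> (T - S'))"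
    by (rule card_mono) (auto simp: T_def S'_def)
  also have "\<dots> \<le> card (pattern \<inter> S') + card (T - S')" by (rule card_Un_le)
  also have "card (T - S') = card T - card S'"
    using \<open>S' \<subseteq> T\<close> by (intro card_Diff_subset) (auto simp: S'_def)
  finally have "card (pattern \<inter> T) + card S' \<le> card (pattern \<inter> S') + card T"
    using card_mono[OF _ \<open>S' \<subseteq> T\<close>] by (simp add: T_def)
  then have "real (card (pattern \<inter> T)) + V \<le> real (card (pattern \<inter> S')) + real (card T)"
    unfolding cards(2)[symmetric] by (simp only: of_nat_add[symmetric] of_nat_le_iff)
  with count dense sparse cards T_card \<open>0 < V\<close> show False by linarith
qed

text \<open>Starting from a pair at the coarsest scale, which is stretched by \<open>1 / L\<close> because the inverse of
\<open>f\<close> is Lipschitz, the stretch is multiplied by \<open>1 + k\<close> at every scale, but never exceeds \<open>L\<close>.\<close>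

lemma stretch_bounded: "(1 + k) ^ m \<le> L\<^sup>2"
proof -
  have "\<exists>x. stretched_pair (m - i) ((1 + k) ^ i / L) x" if "i \<le> m" for i
    using that
  proof (induction i)
    case 0
    have zero: "0 \<in> box" by (simp add: box_def)
    have "axis a (int (width m)) \<in> box"
      unfolding box_def by (auto simp: axis_nth) 
    then have "dist (emb (axis a (int (width m)))) (emb 0) \<le> L * dist (f (emb (axis a (int (width m))))) (f (emb 0))"
      by (intro inverse_lipschitz emb_in_D zero)
    then have "stretched_pair m (1 / L) 0"
      using L_ge_1 by (simp add: stretched_pair_def dist_norm emb_axis norm_axis_of_nat field_simps)
    then show ?case by auto
  next
    case (Suc i)
    then obtain x where "stretched_pair (m - i) ((1 + k) ^ i / L) x" by auto
    moreover have "m - i = Suc (m - Suc i)" using Suc.prems by simp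
    ultimately have "\<exists>y. stretched_pair (m - Suc i) ((1 + k) * ((1 + k) ^ i / L)) y"
      using Suc.prems k_pos L_ge_1 by (intro stretch_gain) auto
    then show ?case by simp
  qed
  from this[of m] obtain x where "stretched_pair 0 ((1 + k) ^ m / L) x" by auto
  then have "(1 + k) ^ m / L \<le> L" by (rule stretch_le_lipschitz[rotated]) simp
  then show ?thesis using L_ge_1 by (simp add: field_simps power2_eq_square)
qed

end

section \<open>Rigid patches\<close>

text \<open>A finite set of extra points that makes the lattice locally incomparable to the lattice: no
\<open>L\<close>-bilipschitz map sends the part in a ball about the origin to lattice points in such a way that
all lattice points near the image of the origin are attained. Only local data enter, so the patch
can be transplanted.\<close>

definition rigid_patch :: "real \<Rightarrow> (int ^ 'n) set \<Rightarrow> real \<Rightarrow> bool" where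
  "rigid_patch L E r \<longleftrightarrow> finite E \<and> 0 \<le> r \<and>
     (\<nexists>f :: real ^ 'n \<Rightarrow> real ^ 'n.
        let D = enriched E UNIV \<inter> cball 0 r in
        (\<forall>x\<in>D. \<forall>y\<in>D. dist (f x) (f y) \<le> L * dist x y \<and> dist x y \<le> L * dist (f x) (f y)) \<and>
        f ` D \<subseteq> range emb \<and>
        (\<forall>y\<in>range emb. dist y (f 0) \<le> r / L \<longrightarrow> y \<in> f ` D))"

lemma rigid_patch_exists:
  assumes "CARD('n::finite) \<ge> 2" "1 \<le> L"
  shows "\<exists>(E :: (int ^ 'n) set) r. rigid_patch L E r"
proof -
  obtain a b :: 'n where ab: "a \<noteq> b"
  proof -
    have "\<not> card (UNIV :: 'n set) \<le> Suc 0" using assms(1) by simp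
    then show thesis using that by (metis UNIV_I card_le_Suc0_iff_eq finite)
  qed
  define d where "d = real CARD('n)"
  have "1 \<le> d" using assms(1) by (simp add: d_def)
  have "(\<lambda>B. (1 + 1 / real B) ^ CARD('n)) \<longlonglongrightarrow> (1 + 0) ^ CARD('n)"
    by (intro tendsto_intros lim_1_over_n)
  then have "\<forall>\<^sub>F B in sequentially. (1 + 1 / real B) ^ CARD('n) < 5 / 4"
    by (rule order_tendstoD) simp
  then have "\<forall>\<^sub>F B in sequentially. 0 < B \<and> (1 + 1 / real B) ^ CARD('n) < 5 / 4"
    using eventually_gt_at_top[of 0] by eventually_elim simp
  then obtain B :: nat where B: "0 < B" "(1 + 1 / real B) ^ CARD('n) < 5 / 4"
    by (auto simp: eventually_at_top_linorder)
  obtain t :: nat where t: "2 * (L\<^sup>2 * d + d + 1) \<le> t"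
    using real_arch_simple by blast
  have "0 \<le> L\<^sup>2 * d" using \<open>1 \<le> d\<close> by simp
  then have "0 < L\<^sup>2 * d + d + 1" using \<open>1 \<le> d\<close> by (simp add: add_nonneg_pos)
  then have "0 < 2 * (L\<^sup>2 * d + d + 1)" by simp
  also note t
  finally have "0 < t" by simp
  define M where "M = 2 * B * t"
  have "0 < M" using B \<open>0 < t\<close> by (simp add: M_def)
  define c where "c = 64 * L\<^sup>2 * real (M ^ CARD('n))"
  have "0 < c" using \<open>0 < M\<close> \<open>1 \<le> L\<close> by (simp add: c_def)
  define k where "k = min 1 ((1 / (4 * B * L))\<^sup>2 / c)"
  have "0 < k" "k \<le> 1" using \<open>0 < c\<close> B \<open>1 \<le> L\<close> by (auto simp: k_def)
  have "c * k \<le> c * ((1 / (4 * B * L))\<^sup>2 / c)"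
    using \<open>0 < c\<close> by (intro mult_left_mono) (auto simp: k_def)
  then have ck: "c * k \<le> (1 / (4 * B * L))\<^sup>2" using \<open>0 < c\<close> by simp
  obtain m where m: "L\<^sup>2 < (1 + k) ^ m"
    using real_arch_pow[of "1 + k" "L\<^sup>2"] \<open>0 < k\<close> by auto
  obtain K0 :: nat where K0: "max (8 * real m) (2 * d / k) \<le> K0"
    using real_arch_simple by blast
  define K where "K = 2 * (K0 + 1)"
  have K: "even K" "0 < K" by (simp_all add: K_def)
  have "8 * real m \<le> K" "2 * d / k \<le> K" using K0 by (auto simp: K_def)
  then have K8: "8 * m \<le> K" and "2 * d \<le> k * K"
    using \<open>0 < k\<close> by (linarith, simp add: divide_le_eq mult.commute)
  interpret nested_tubes a b M K m
    by unfold_locales (use ab \<open>0 < M\<close> K in auto)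
  define r where "r = 2 * L\<^sup>2 * CARD('n) * (2 * (m + 2) * width m + 1)"
  have "0 \<le> r" by (simp add: r_def)
  \<comment> \<open>points outside the ball are irrelevant; dropping them makes the patch finite\<close>
  define E where "E = {z \<in> pattern. norm (emb z + half) \<le> r}"
  have D_eq: "enriched E UNIV \<inter> cball 0 r = enriched pattern UNIV \<inter> cball 0 r"
    by (auto simp: E_def enriched_def)
  have "finite E"
  proof -
    have "z $ i \<in> {- \<lceil>r\<rceil> - 1..\<lceil>r\<rceil> + 1}" if "z \<in> E" for z i
    proof -
      have "\<bar>(emb z + half) $ i\<bar> \<le> r"
        using component_le_norm_cart[of "emb z + half" i] that by (simp add: E_def)
      then show ?thesis by (simp add: abs_le_iff) linarith
    qed
    then have "E \<subseteq> {z. \<forall>i. z $ i \<in> {- \<lceil>r\<rceil> - 1..\<lceil>r\<rceil> + 1}}" by blast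
    moreover have "finite {z :: int ^ 'n. \<forall>i. z $ i \<in> {- \<lceil>r\<rceil> - 1..\<lceil>r\<rceil> + 1}}"
      by (rule finite_vectors) simp
    ultimately show ?thesis by (rule finite_subset)
  qed
  have impossible: False
    if "\<forall>x\<in>D. \<forall>y\<in>D. dist (f x) (f y) \<le> L * dist x y \<and> dist x y \<le> L * dist (f x) (f y)"
      "f ` D \<subseteq> range emb" "\<forall>y\<in>range emb. dist y (f 0) \<le> r / L \<longrightarrow> y \<in> f ` D"
      "D = enriched E UNIV \<inter> cball 0 r" for f :: "real ^ 'n \<Rightarrow> real ^ 'n" and D
  proof -
    interpret bilipschitz_pattern a b M K m L k r B t f D
    proof unfold_locales
      show "D = enriched pattern UNIV \<inter> cball 0 r" using that(4) D_eq by simp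
      show "64 * L\<^sup>2 * real (M ^ CARD('n)) * k \<le> (1 / (4 * B * L))\<^sup>2"
        using ck by (simp add: c_def)
      show "(1 + 1 / B) ^ CARD('n) \<le> (5 / 4 :: real)" using B(2) by simp
      show "2 * (L\<^sup>2 * CARD('n) + CARD('n) + 1) \<le> t" using t by (simp add: d_def)
      show "2 * CARD('n) \<le> k * K" using \<open>2 * d \<le> k * K\<close> by (simp add: d_def)
      show "2 * L\<^sup>2 * CARD('n) * (2 * (m + 2) * width m + 1) \<le> r" by (simp only: r_def)
      show "\<And>x y. x \<in> D \<Longrightarrow> y \<in> D \<Longrightarrow> dist (f x) (f y) \<le> L * dist x y"
        "\<And>x y. x \<in> D \<Longrightarrow> y \<in> D \<Longrightarrow> dist x y \<le> L * dist (f x) (f y)"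
        "\<And>y. y \<in> range emb \<Longrightarrow> dist y (f 0) \<le> r / L \<Longrightarrow> y \<in> f ` D"
        using that by blast+
    qed (fact B(1) M_def \<open>1 \<le> L\<close> \<open>0 < k\<close> \<open>k \<le> 1\<close> K(1) K8 that(2))+
    show False using stretch_bounded m by linarith
  qed
  have "rigid_patch L E r"
    unfolding rigid_patch_def Let_def
  proof (intro conjI notI)
    assume "\<exists>f :: real ^ 'n \<Rightarrow> real ^ 'n.
      (\<forall>x\<in>enriched E UNIV \<inter> cball 0 r. \<forall>y\<in>enriched E UNIV \<inter> cball 0 r.
        dist (f x) (f y) \<le> L * dist x y \<and> dist x y \<le> L * dist (f x) (f y)) \<and>
      f ` (enriched E UNIV \<inter> cball 0 r) \<subseteq> range emb \<and>
      (\<forall>y\<in>range emb. dist y (f 0) \<le> r / L \<longrightarrow> y \<in> f ` (enriched E UNIV \<inter> cball 0 r))"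
    then show False by (elim exE conjE) (rule impossible[OF _ _ _ refl])
  qed fact+
  then show ?thesis by blast
qed

section \<open>Sparse positions and almost disjoint families\<close>

text \<open>Patches are placed one after the other, each as far out as its predecessors and the growth of the
displacement bound demand. The positions are even in order that all holes have even coordinates.\<close>

lemma growing_sequence:
  fixes P :: "nat \<Rightarrow> nat \<Rightarrow> bool" and G :: "nat \<Rightarrow> nat \<Rightarrow> nat \<Rightarrow> nat"
  assumes "\<And>k. \<exists>c0. \<forall>c\<ge>c0. P k c"
  obtains c where "\<And>k. even (c k)" "\<And>k. P k (c k)" "\<And>j k. j < k \<Longrightarrow> G j k (c j) \<le> c k"
proof -
  have "\<exists>c. \<forall>k. even (c k) \<and> P k (c k) \<and> (\<forall>j<k. G j k (c j) \<le> c k)"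
  proof (rule dependent_wf_choice[where R = "{(x, y :: nat). x < y}"
        and P = "\<lambda>f k v. even v \<and> P k v \<and> (\<forall>j<k. G j k (f j) \<le> v)"])
    fix k and f :: "nat \<Rightarrow> nat"
    obtain c0 where c0: "\<forall>c\<ge>c0. P k c" using assms by blast
    let ?v = "2 * (c0 + (\<Sum>j<k. G j k (f j)))"
    have "G j k (f j) \<le> (\<Sum>j<k. G j k (f j))" if "j < k" for j
      by (rule member_le_sum) (use that in auto)
    then have "\<forall>j<k. G j k (f j) \<le> ?v" by (force intro: trans_le_add2)
    then show "\<exists>v. even v \<and> P k v \<and> (\<forall>j<k. G j k (f j) \<le> v)"
      using c0 by (intro exI[of _ ?v]) auto
  qed (auto simp: wf)
  with that show thesis by blast
qed

text \<open>The classical almost disjoint family: a number encodes a length \<open>n\<close> and the initial segment of \<open>A\<close>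
of that length, so that two different sets share only finitely many codes.\<close>

definition prefix_codes :: "nat set \<Rightarrow> nat set" where
  "prefix_codes A = range (\<lambda>n. prod_encode (n, set_encode (A \<inter> {..<n})))"

lemma infinite_prefix_codes_diff:
  assumes "A \<noteq> B"
  shows "infinite (prefix_codes A - prefix_codes B)"
proof -
  obtain i where i: "i \<in> A \<longleftrightarrow> i \<notin> B" using assms by blast
  let ?code = "\<lambda>n. prod_encode (n, set_encode (A \<inter> {..<n}))"
  have "?code n \<notin> prefix_codes B" if "i < n" for n
  proof
    assume "?code n \<in> prefix_codes B"
    then have "set_encode (A \<inter> {..<n}) = set_encode (B \<inter> {..<n})"
      by (auto simp: prefix_codes_def)
    then have "A \<inter> {..<n} = B \<inter> {..<n}"
      using inj_on_set_encode by (auto simp: inj_on_def)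
    then show False using i that by blast
  qed
  then have "?code ` {i<..} \<subseteq> prefix_codes A - prefix_codes B"
    by (auto simp: prefix_codes_def)
  moreover have "infinite (?code ` {i<..})"
    by (subst finite_image_iff) (auto simp: inj_on_def infinite_Ioi)
  ultimately show ?thesis by (meson finite_subset)
qed

lemma uncountable_nat_sets: "uncountable (UNIV :: nat set set)"
  unfolding uncountable_def using Cantors_theorem[of "UNIV :: nat set"] by simp

lemma separated_subset_half_lattice:
  fixes X :: "(real ^ 'n) set"
  assumes "X \<subseteq> range emb \<union> range (\<lambda>z. emb z + half)"
  shows "separated X"
proof -
  have "1 / 2 \<le> norm (x - y)" if xy: "x \<in> X" "y \<in> X" "x \<noteq> y" for x y
  proof -
    from \<open>x \<noteq> y\<close> obtain i where i: "x $ i \<noteq> y $ i" by (auto simp: vec_eq_iff)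
    have "\<exists>u :: int. 2 * x $ i = u" if "x \<in> X" for x
    proof -
      have "x \<in> range emb \<union> range (\<lambda>z. emb z + half)" using that assms by blast
      then obtain z where "x = emb z \<or> x = emb z + half" by auto
      then have "2 * x $ i = real_of_int (2 * z $ i) \<or> 2 * x $ i = real_of_int (2 * z $ i + 1)"
        by auto
      then show ?thesis by blast
    qed
    then obtain u v :: int where uv: "2 * x $ i = u" "2 * y $ i = v" using xy(1,2) by blast
    then have "u \<noteq> v" using i by auto
    then have "1 \<le> \<bar>u - v\<bar>" by linarith
    then have "1 \<le> \<bar>real_of_int u - real_of_int v\<bar>" by linarith
    then have "1 \<le> 2 * \<bar>(x - y) $ i\<bar>" unfolding uv[symmetric] vector_minus_component by (auto simp: abs_if split: if_splits)
    then show ?thesis using component_le_norm_cart[of "x - y" i] by linarith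
  qed
  then have "ereal (1 / 2) \<le> Inf {ereal (norm (z - z')) | z z'. z \<in> X \<and> z' \<in> X \<and> z \<noteq> z'}"
    by (auto intro!: Inf_greatest)
  then show ?thesis
    unfolding separated_def by (rule less_le_trans[rotated]) simp
qed

section \<open>Lattices with patches\<close>

text \<open>Patch \<open>k\<close> is centred at distance \<open>c k\<close> in direction \<open>a\<close> and lives in a ball of radius \<open>6 * \<rho> k\<close>.
The inequality \<open>gap\<close> ensures not only that patches are disjoint, but also that a map with bilipschitz
constant \<open>k + 1\<close> and moderate value at the origin cannot move patch \<open>k\<close> close to another patch.\<close>

locale patched_lattice =
  fixes a :: "'n::finite" and c \<rho> :: "nat \<Rightarrow> nat" and E :: "nat \<Rightarrow> (int ^ 'n) set"
  assumes c_even: "even (c k)" and \<rho>_pos: "1 \<le> \<rho> k" and c_large: "6 * \<rho> k < c k"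
    and E_bounded: "z \<in> E k \<Longrightarrow> norm (emb z) \<le> \<rho> k" "z \<in> E k \<Longrightarrow> norm (emb z + half) \<le> \<rho> k"
    and gap: "j < k \<Longrightarrow> (k + 2) * (c j + 10 * \<rho> j + 10 * \<rho> k + k + 1) \<le> c k"
begin

definition centre :: "nat \<Rightarrow> int ^ 'n" where
  "centre k = axis a (int (c k))"

definition extra :: "nat \<Rightarrow> int ^ 'n \<Rightarrow> real ^ 'n" where
  "extra k z = emb (centre k + z) + half"

text \<open>For every extra point one lattice point is removed nearby, which restores the bijection with the
lattice. Doubling \<open>z\<close> makes the coordinates even, so every removed point has neighbours that are
kept; the shift by \<open>4 * \<rho> k\<close> moves the holes out of the ball of radius \<open>\<rho> k\<close> in which the
patch has to remain intact.\<close>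

definition hole :: "nat \<Rightarrow> int ^ 'n \<Rightarrow> int ^ 'n" where
  "hole k z = centre k + axis a (int (4 * \<rho> k)) + (z + z)"

definition patched :: "nat set \<Rightarrow> (real ^ 'n) set" where
  "patched \<psi> = emb ` (- (\<Union>k\<in>\<psi>. hole k ` E k)) \<union> (\<Union>k\<in>\<psi>. extra k ` E k)"

definition region :: "nat \<Rightarrow> (real ^ 'n) set" where
  "region k = cball (emb (centre k)) (6 * \<rho> k)"

lemma norm_centre: "norm (emb (centre k)) = c k"
  by (simp add: centre_def emb_axis norm_axis_of_nat)

lemma extra_near: "z \<in> E k \<Longrightarrow> dist (extra k z) (emb (centre k)) \<le> \<rho> k"
  using E_bounded(2)[of z k] by (simp add: extra_def emb_add dist_norm add.assoc)

lemma hole_distance: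
  assumes "z \<in> E k"
  shows "2 * \<rho> k \<le> dist (emb (hole k z)) (emb (centre k))"
    and "dist (emb (hole k z)) (emb (centre k)) \<le> 6 * \<rho> k"
proof -
  have eq: "emb (hole k z) - emb (centre k) = axis a (real (4 * \<rho> k)) + 2 *\<^sub>R emb z"
    by (simp only: hole_def emb_add emb_axis scaleR_2) simp
  have z: "norm (2 *\<^sub>R emb z) \<le> 2 * \<rho> k" using E_bounded(1)[OF assms] by simp
  show "2 * \<rho> k \<le> dist (emb (hole k z)) (emb (centre k))"
    unfolding dist_norm eq using z norm_diff_ineq[of "axis a (real (4 * \<rho> k))" "2 *\<^sub>R emb z"]
    unfolding norm_axis_of_nat by simp
  show "dist (emb (hole k z)) (emb (centre k)) \<le> 6 * \<rho> k"
    unfolding dist_norm eq using z norm_triangle_ineq[of "axis a (real (4 * \<rho> k))" "2 *\<^sub>R emb z"]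
    unfolding norm_axis_of_nat by simp
qed

lemma extra_in_region: "z \<in> E k \<Longrightarrow> extra k z \<in> region k"
  using extra_near[of z k] by (simp add: region_def dist_commute)

lemma hole_in_region: "z \<in> E k \<Longrightarrow> emb (hole k z) \<in> region k"
  using hole_distance(2)[of z k] by (simp add: region_def dist_commute)

lemma norm_region:
  assumes "v \<in> region k"
  shows "real (c k) - 6 * \<rho> k \<le> norm v" "norm v \<le> real (c k) + 6 * \<rho> k"
  using assms norm_triangle_ineq2[of "emb (centre k)" v] norm_triangle_ineq2[of v "emb (centre k)"]
  by (auto simp: region_def dist_norm norm_centre norm_minus_commute)

text \<open>The norms that can occur for points near the image of patch \<open>k\<close> under a bilipschitz map with
constant \<open>k + 1\<close> that sends the origin to a point of norm at most \<open>k\<close>. The slack \<open>7 * \<rho> k\<close> makes the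
region of the patch itself part of the window, so that \<open>window_disjoint_region\<close> also separates the
patches from each other.\<close>

definition window :: "nat \<Rightarrow> (real ^ 'n) set" where
  "window k = {v. (real (c k) - \<rho> k) / (real k + 1) - k - 7 * \<rho> k \<le> norm v \<and>
                  norm v \<le> (real k + 1) * (real (c k) + \<rho> k) + k + 7 * \<rho> k}"

lemma window_disjoint_region:
  assumes "j \<noteq> k"
  shows "window k \<inter> region j = {}"
proof -
  have False if v: "v \<in> window k" "v \<in> region j" for v
    using \<open>j \<noteq> k\<close>
  proof (cases j k rule: linorder_cases)
    case less
    \<comment> \<open>the image of patch \<open>k\<close> lies beyond patch \<open>j\<close>\<close>
    define Q where "Q = real (c j) + 10 * \<rho> j + 10 * \<rho> k + k + 1"
    have "real ((k + 2) * (c j + 10 * \<rho> j + 10 * \<rho> k + k + 1)) \<le> real (c k)"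
      using gap[OF less] by (simp only: of_nat_le_iff)
    then have "(real k + 1) * Q + Q \<le> real (c k)" by (simp add: Q_def algebra_simps)
    moreover have "real (\<rho> k) < Q" by (simp add: Q_def)
    ultimately have "(real k + 1) * Q < real (c k) - \<rho> k" by linarith
    then have "Q < (real (c k) - \<rho> k) / (real k + 1)" by (simp add: field_simps)
    then have "Q < real (c j) + 6 * \<rho> j + k + 7 * \<rho> k"
      using v(1) norm_region(2)[OF v(2)] by (simp add: window_def)
    then show False by (simp add: Q_def)
  next
    case greater
    \<comment> \<open>the image of patch \<open>k\<close> lies short of patch \<open>j\<close>\<close>
    define Q where "Q = real (c k) + 10 * \<rho> k + 10 * \<rho> j + j + 1"
    have "real ((j + 2) * (c k + 10 * \<rho> k + 10 * \<rho> j + j + 1)) \<le> real (c j)"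
      using gap[OF greater] by (simp only: of_nat_le_iff)
    then have "(real j + 1) * Q + Q \<le> real (c j)" by (simp add: Q_def algebra_simps)
    moreover have "(real k + 1) * (real (c k) + \<rho> k) \<le> (real j + 1) * Q"
      using greater by (intro mult_mono) (auto simp: Q_def)
    ultimately have "(real k + 1) * (real (c k) + \<rho> k) + Q \<le> real (c j)"
      by simp
    moreover have "real (c j) - 6 * \<rho> j \<le> (real k + 1) * (real (c k) + \<rho> k) + k + 7 * \<rho> k"
      using v(1) norm_region(1)[OF v(2)] by (simp add: window_def)
    ultimately show False using greater by (simp add: Q_def)
  qed simp
  then show ?thesis by blast
qed

lemma region_subset_window: "region k \<subseteq> window k"
proof
  fix v assume "v \<in> region k"
  note v = norm_region[OF this]
  have "0 \<le> real (c k) - \<rho> k" using c_large[of k] by simp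
  then have "(real (c k) - \<rho> k) / (real k + 1) \<le> real (c k) - \<rho> k"
    by (simp add: divide_le_eq mult_le_cancel_left1)
  moreover have "1 * (real (c k) + \<rho> k) \<le> (real k + 1) * (real (c k) + \<rho> k)"
    by (intro mult_right_mono) auto
  ultimately show "v \<in> window k" unfolding window_def using v by simp
qed

lemma region_disjoint: "j \<noteq> k \<Longrightarrow> region j \<inter> region k = {}"
  using window_disjoint_region[of j k] region_subset_window[of k] by blast

lemma region_neq: "v \<in> region j \<Longrightarrow> v \<in> region k \<Longrightarrow> j = k"
  using region_disjoint by blast

lemma zero_notin_region: "0 \<notin> region k"
  using norm_region(1)[of 0 k] c_large[of k] by auto

lemma separated_patched: "separated (patched \<psi>)"
  by (rule separated_subset_half_lattice) (auto simp: patched_def extra_def)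

lemma hole_even: "even (hole k z $ i)"
  using c_even[of k] by (simp add: hole_def centre_def axis_def)

text \<open>Holes have even coordinates, so the lattice points with odd coordinates survive.\<close>

lemma net_patched: "net (patched \<psi>)"
proof -
  have "(INF z\<in>patched \<psi>. ereal (norm (z - x))) \<le> ereal (real CARD('n) * 2)" for x
  proof -
    define z :: "int ^ 'n" where "z = (\<chi> i. 2 * \<lfloor>x $ i / 2\<rfloor> + 1)"
    have "odd (z $ i)" for i by (simp add: z_def)
    then have "z \<noteq> hole k y" for k y using hole_even by metis
    then have "emb z \<in> patched \<psi>" by (auto simp: patched_def)
    moreover have "norm (emb z - x) \<le> real CARD('n) * 2"
    proof (rule norm_le_card_mult)
      fix i
      have "\<bar>real_of_int (2 * \<lfloor>x $ i / 2\<rfloor> + 1) - x $ i\<bar> \<le> 2" by linarith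
      then show "\<bar>(emb z - x) $ i\<bar> \<le> 2" by (simp add: z_def)
    qed
    ultimately show ?thesis by (intro INF_lower2[of "emb z"]) auto
  qed
  then have "(SUP x. INF z\<in>patched \<psi>. ereal (norm (z - x))) \<le> ereal (real CARD('n) * 2)"
    by (intro SUP_least)
  then show ?thesis unfolding net_def by (rule le_less_trans) simp
qed

lemma extra_inj:
  assumes "z \<in> E k" "z' \<in> E k'" "extra k z = extra k' z'"
  shows "k = k' \<and> z = z'"
proof -
  have "k = k'" using extra_in_region[OF assms(1)] extra_in_region[OF assms(2)] assms(3) region_neq by simp
  with assms(3) show ?thesis by (simp add: extra_def)
qed

lemma hole_inj:
  assumes "z \<in> E k" "z' \<in> E k'" "hole k z = hole k' z'"
  shows "k = k' \<and> z = z'"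
proof -
  have "k = k'" using hole_in_region[OF assms(1)] hole_in_region[OF assms(2)] assms(3) region_neq by simp
  with assms(3) show ?thesis by (simp add: hole_def vec_eq_iff)
qed

lemma extra_notin_lattice: "extra k z \<notin> range emb"
  by (auto simp: extra_def)

text \<open>Each extra point goes to its own hole, everything else stays in place; \<open>extra_inj\<close> makes the choice
of \<open>(k, z)\<close> unique.\<close>

definition fill :: "nat set \<Rightarrow> real ^ 'n \<Rightarrow> real ^ 'n" where
  "fill \<psi> x = (if x \<in> range emb then x
     else (let (k, z) = (SOME (k, z). k \<in> \<psi> \<and> z \<in> E k \<and> x = extra k z) in emb (hole k z)))"

lemma fill_extra:
  assumes "k \<in> \<psi>" "z \<in> E k"
  shows "fill \<psi> (extra k z) = emb (hole k z)"
proof -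
  have "(SOME (k', z'). k' \<in> \<psi> \<and> z' \<in> E k' \<and> extra k z = extra k' z') = (k, z)"
    using assms extra_inj[OF assms(2)] by (intro some_equality) auto
  then show ?thesis using extra_notin_lattice by (simp add: fill_def)
qed

lemma bij_betw_fill: "bij_betw (fill \<psi>) (patched \<psi>) integer_lattice"
proof -
  let ?H = "\<Union>k\<in>\<psi>. hole k ` E k"
  have "bij_betw (fill \<psi>) (emb ` (- ?H)) (emb ` (- ?H))"
    using bij_betw_id by (rule bij_betw_cong[THEN iffD1, rotated]) (auto simp: fill_def)
  moreover have "bij_betw (fill \<psi>) (\<Union>k\<in>\<psi>. extra k ` E k) (emb ` ?H)"
  proof (rule bij_betwI')
    show "fill \<psi> x = fill \<psi> y \<longleftrightarrow> x = y"
      if xy: "x \<in> (\<Union>k\<in>\<psi>. extra k ` E k)" "y \<in> (\<Union>k\<in>\<psi>. extra k ` E k)" for x y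
    proof -
      obtain k z where x: "k \<in> \<psi>" "z \<in> E k" "x = extra k z" using xy(1) by blast
      obtain k' z' where y: "k' \<in> \<psi>" "z' \<in> E k'" "y = extra k' z'" using xy(2) by blast
      have "extra k z = extra k' z' \<longleftrightarrow> hole k z = hole k' z'"
        using hole_inj[OF x(2) y(2)] extra_inj[OF x(2) y(2)] by blast
      then show ?thesis by (simp add: x y fill_extra)
    qed
  next
    fix x assume "x \<in> (\<Union>k\<in>\<psi>. extra k ` E k)"
    then obtain k z where "k \<in> \<psi>" "z \<in> E k" "x = extra k z" by blast
    moreover from this have "fill \<psi> x = emb (hole k z)" by (simp add: fill_extra)
    ultimately show "fill \<psi> x \<in> emb ` ?H" by blast
  next
    fix y assume "y \<in> emb ` ?H"
    then obtain k z where "k \<in> \<psi>" "z \<in> E k" "y = emb (hole k z)" by blast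
    then have "extra k z \<in> (\<Union>k\<in>\<psi>. extra k ` E k)" "y = fill \<psi> (extra k z)"
      by (auto simp: fill_extra)
    then show "\<exists>x\<in>(\<Union>k\<in>\<psi>. extra k ` E k). y = fill \<psi> x" by blast
  qed
  ultimately have "bij_betw (fill \<psi>) (patched \<psi>) (emb ` (- ?H) \<union> emb ` ?H)"
    unfolding patched_def by (rule bij_betw_combine) (use emb_eq_iff[THEN iffD1] in blast)
  moreover have "emb ` (- ?H) \<union> emb ` ?H = (integer_lattice :: (real ^ 'n) set)"
    unfolding integer_lattice_eq_range_emb by blast
  ultimately show ?thesis by simp
qed

text \<open>Points of patch \<open>k\<close> have norm at least \<open>c k - 6 * \<rho> k\<close> and are moved by at most \<open>12 * \<rho> k\<close>, and
\<open>c k\<close> is so large that \<open>\<phi>\<close> is at least this from there on.\<close>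

lemma displacement_equivalent_patched:
  fixes \<phi> :: "real \<Rightarrow> real"
  assumes \<phi>: "\<And>k R. real (c k) - 6 * \<rho> k \<le> R \<Longrightarrow> 12 * \<rho> k \<le> \<phi> R"
    and pos: "\<And>R. 0 < R \<Longrightarrow> 0 < \<phi> R"
  shows "displacement_equivalent \<phi> (patched \<psi>) integer_lattice"
proof -
  have moved: "norm (fill \<psi> x - x) \<le> \<phi> R" if x: "x \<in> patched \<psi>" and "norm x \<le> R" "0 < R" for x R
  proof (cases "x \<in> range emb")
    case True
    then show ?thesis using pos[OF that(3)] by (simp add: fill_def)
  next
    case False
    then obtain k z where kz: "k \<in> \<psi>" "z \<in> E k" "x = extra k z"
      using x unfolding patched_def by blast
    have "norm (fill \<psi> x - x) \<le> dist (emb (hole k z)) (emb (centre k)) + dist (extra k z) (emb (centre k))"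
      unfolding kz(3) fill_extra[OF kz(1,2)] dist_norm[symmetric] by (rule dist_triangle2)
    also have "\<dots> \<le> 12 * \<rho> k"
      using hole_distance(2)[OF kz(2)] extra_near[OF kz(2)] by linarith
    also have "\<dots> \<le> \<phi> R"
      using norm_region(1)[OF extra_in_region[OF kz(2)]] that(2) by (intro \<phi>) (simp add: kz(3))
    finally show ?thesis .
  qed
  have "disp (patched \<psi>) (fill \<psi>) R / ereal (\<phi> R) \<le> 1" if "0 < R" for R
  proof -
    have "disp (patched \<psi>) (fill \<psi>) R \<le> ereal (\<phi> R)"
      using moved[OF _ _ that] pos[OF that] by (auto simp: disp_def intro!: SUP_least)
    then show ?thesis
      using pos[OF that] by (simp add: ereal_divide_le_pos)
  qed
  then have "\<forall>\<^sub>F R in at_top. disp (patched \<psi>) (fill \<psi>) R / ereal (\<phi> R) \<le> 1"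
    using eventually_gt_at_top[of 0] by (rule eventually_mono[rotated]) 
  then have "Limsup at_top (\<lambda>R. disp (patched \<psi>) (fill \<psi>) R / ereal (\<phi> R)) \<le> 1"
    by (rule Limsup_bounded)
  then have "Limsup at_top (\<lambda>R. disp (patched \<psi>) (fill \<psi>) R / ereal (\<phi> R)) < \<infinity>"
    by (rule le_less_trans) simp
  with bij_betw_fill show ?thesis
    unfolding displacement_equivalent_def by blast
qed

lemma patched_near_centre:
  assumes "norm x \<le> \<rho> k" "k \<in> \<psi>"
  shows "x + emb (centre k) \<in> patched \<psi> \<longleftrightarrow> x \<in> enriched (E k) UNIV"
proof -
  let ?u = "x + emb (centre k)"
  have u: "dist ?u (emb (centre k)) \<le> \<rho> k" using assms(1) by (simp add: dist_norm)
  then have reg: "?u \<in> region k" by (simp add: region_def dist_commute)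
  show ?thesis
  proof
    assume "?u \<in> patched \<psi>"
    then consider z where "?u = emb z" | j z where "j \<in> \<psi>" "z \<in> E j" "?u = extra j z"
      by (auto simp: patched_def)
    then show "x \<in> enriched (E k) UNIV"
    proof cases
      case 1
      then have "x = emb (z - centre k)" by (simp add: emb_diff algebra_simps)
      then show ?thesis by (simp add: enriched_def)
    next
      case 2
      then have "j = k" using reg extra_in_region region_neq by metis
      with 2 have "x = emb z + half" "z \<in> E k" by (simp_all add: extra_def emb_add algebra_simps)
      then show ?thesis by (simp add: enriched_def)
    qed
  next
    assume "x \<in> enriched (E k) UNIV"
    then consider z where "x = emb z" | z where "z \<in> E k" "x = emb z + half"
      by (auto simp: enriched_def)
    then show "?u \<in> patched \<psi>"
    proof cases
      case 1
      then have eq: "?u = emb (z + centre k)" by (simp add: emb_add)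
      have "z + centre k \<noteq> hole j y" if "y \<in> E j" for j y
      proof
        assume h: "z + centre k = hole j y"
        then have "j = k" using hole_in_region[OF that] reg eq region_neq by metis
        then have "2 * \<rho> k \<le> dist ?u (emb (centre k))"
          using hole_distance(1)[OF that] h eq by simp
        then show False using u \<rho>_pos[of k] by simp
      qed
      then show ?thesis unfolding eq patched_def by blast
    next
      case 2
      then have "?u = extra k z" by (simp add: extra_def emb_add algebra_simps)
      then show ?thesis using 2 assms(2) by (auto simp: patched_def)
    qed
  qed
qed

lemma patched_outside_regions:
  assumes "\<And>j. j \<in> \<psi> \<Longrightarrow> v \<notin> region j"
  shows "v \<in> patched \<psi> \<longleftrightarrow> v \<in> range emb"
proof -
  have "v \<noteq> extra k z" "v \<noteq> emb (hole k z)" if "k \<in> \<psi>" "z \<in> E k" for k z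
    using assms[OF that(1)] extra_in_region[OF that(2)] hole_in_region[OF that(2)] by auto
  then show ?thesis unfolding patched_def by blast
qed

lemma zero_in_patched: "0 \<in> patched \<psi>"
  using patched_outside_regions[of \<psi> 0] zero_notin_region by (metis emb_zero rangeI)

text \<open>Infinitely many patches of the first net are absent from the second one; choose one whose index \<open>k\<close>
exceeds the bilipschitz constants and the norm of the image of the origin. Its image lies in
\<open>window k\<close>, where the second net coincides with the lattice because it has no patch \<open>k\<close> there. This
contradicts the rigidity of the patch.\<close>

lemma not_bilipschitz_equivalent_patched:
  assumes rigid: "\<And>k. rigid_patch (real k + 1) (E k) (r k)" and r_le: "\<And>k. r k \<le> \<rho> k"
    and inf: "infinite (\<psi> - \<psi>')"
  shows "\<not> bilipschitz_equivalent (patched \<psi>) (patched \<psi>')"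
proof
  assume "bilipschitz_equivalent (patched \<psi>) (patched \<psi>')"
  then obtain f L1 L2 where bij: "bij_betw f (patched \<psi>) (patched \<psi>')"
    and L1: "L1-lipschitz_on (patched \<psi>) f"
    and L2: "L2-lipschitz_on (patched \<psi>') (inv_into (patched \<psi>) f)"
    by (auto simp: bilipschitz_equivalent_def)
  obtain k0 :: nat where k0: "max (max L1 L2) (norm (f 0)) \<le> k0"
    using real_arch_simple by blast
  obtain k where k: "k \<in> \<psi>" "k \<notin> \<psi>'" "k0 \<le> k"
    using inf unfolding infinite_nat_iff_unbounded_le by blast
  have bounds: "L1 \<le> k" "L2 \<le> k" "norm (f 0) \<le> k" using k0 k(3) by auto
  have lip: "dist (f u) (f v) \<le> (real k + 1) * dist u v" if "u \<in> patched \<psi>" "v \<in> patched \<psi>" for u v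
    using lipschitz_onD[OF L1 that] mult_right_mono[of L1 "real k + 1" "dist u v"] bounds(1) by simp
  have colip: "dist u v \<le> (real k + 1) * dist (f u) (f v)" if "u \<in> patched \<psi>" "v \<in> patched \<psi>" for u v
  proof -
    have "f u \<in> patched \<psi>'" "f v \<in> patched \<psi>'" using bij that by (auto simp: bij_betw_def)
    then have "dist u v \<le> L2 * dist (f u) (f v)"
      using lipschitz_onD[OF L2, of "f u" "f v"] that bij by (simp add: bij_betw_def inv_into_f_f)
    then show ?thesis
      using mult_right_mono[of L2 "real k + 1" "dist (f u) (f v)"] bounds(2) by simp
  qed
  let ?p = "emb (centre k)"
  have "0 \<le> r k" using rigid[of k] by (simp add: rigid_patch_def)
  have p: "?p \<in> patched \<psi>"
    using patched_near_centre[of 0 k \<psi>] k(1) by (auto simp: enriched_def image_iff intro!: exI[of _ 0])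
  have in_window: "v \<in> window k" if "u \<in> patched \<psi>" "dist u ?p \<le> \<rho> k" "dist v (f u) \<le> \<rho> k" for u v
  proof -
    have u: "real (c k) - \<rho> k \<le> norm u" "norm u \<le> real (c k) + \<rho> k"
      using that(2) norm_triangle_ineq2[of ?p u] norm_triangle_ineq2[of u ?p]
      by (auto simp: dist_norm norm_centre norm_minus_commute)
    have "norm u \<le> (real k + 1) * dist (f u) (f 0)"
      using colip[OF that(1) zero_in_patched] by (simp add: dist_norm)
    then have "real (c k) - \<rho> k \<le> (real k + 1) * dist (f u) (f 0)" using u(1) by linarith
    then have "(real (c k) - \<rho> k) / (real k + 1) \<le> dist (f u) (f 0)"
      by (simp add: divide_le_eq mult.commute)
    moreover have "dist (f u) (f 0) \<le> (real k + 1) * (real (c k) + \<rho> k)"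
    proof -
      have "dist (f u) (f 0) \<le> (real k + 1) * norm u"
        using lip[OF that(1) zero_in_patched] by (simp add: dist_norm)
      also have "\<dots> \<le> (real k + 1) * (real (c k) + \<rho> k)"
        using u(2) by (intro mult_left_mono) auto
      finally show ?thesis .
    qed
    moreover have "norm v \<le> dist v (f u) + dist (f u) (f 0) + norm (f 0)"
      using dist_triangle[of v 0 "f u"] dist_triangle[of "f u" 0 "f 0"] by simp
    moreover have "dist (f u) (f 0) \<le> dist v (f u) + norm v + norm (f 0)"
      using dist_triangle3[of "f u" "f 0" v] dist_triangle[of v "f 0" 0] by simp
    ultimately show ?thesis
      using bounds(3) that(3) by (simp add: window_def)
  qed
  have clean: "v \<in> patched \<psi>' \<longleftrightarrow> v \<in> range emb" if "v \<in> window k" for v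
  proof (rule patched_outside_regions)
    fix j assume "j \<in> \<psi>'"
    with k(2) have "j \<noteq> k" by blast
    then show "v \<notin> region j" using window_disjoint_region[of j k] that by blast
  qed

  define g where "g x = f (x + ?p)" for x
  define D where "D = enriched (E k) UNIV \<inter> cball 0 (r k)"
  have D: "x + ?p \<in> patched \<psi>" "dist (x + ?p) ?p \<le> \<rho> k" if "x \<in> D" for x
    using that r_le[of k] patched_near_centre[of x k \<psi>] k(1) by (auto simp: D_def dist_norm)
  have "dist (g x) (g y) \<le> (real k + 1) * dist x y \<and> dist x y \<le> (real k + 1) * dist (g x) (g y)"
    if "x \<in> D" "y \<in> D" for x y
    using lip[OF D(1)[OF that(1)] D(1)[OF that(2)]] colip[OF D(1)[OF that(1)] D(1)[OF that(2)]]
    by (simp add: g_def)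
  moreover have "g ` D \<subseteq> range emb"
  proof
    fix y assume "y \<in> g ` D"
    then obtain x where x: "x \<in> D" "y = f (x + ?p)" by (auto simp: g_def)
    then have "y \<in> window k" using in_window[OF D[OF x(1)], of y] by simp
    moreover have "y \<in> patched \<psi>'" using bij D(1)[OF x(1)] x(2) by (auto simp: bij_betw_def)
    ultimately show "y \<in> range emb" using clean by blast
  qed
  moreover have "y \<in> g ` D" if "y \<in> range emb" "dist y (g 0) \<le> r k / (real k + 1)" for y
  proof -
    have near: "(real k + 1) * dist y (f ?p) \<le> r k"
      using that(2) by (simp add: g_def le_divide_eq mult.commute)
    have "1 * dist y (f ?p) \<le> (real k + 1) * dist y (f ?p)" by (intro mult_right_mono) auto
    then have "dist y (f ?p) \<le> \<rho> k" using near r_le[of k] by linarith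
    then have "y \<in> window k" using in_window[OF p, of y] by simp
    then have "y \<in> patched \<psi>'" using clean that(1) by blast
    then obtain u where u: "u \<in> patched \<psi>" "y = f u" using bij by (auto simp: bij_betw_def)
    have "dist u ?p \<le> r k" using colip[OF u(1) p] near u(2) by simp
    then have "norm (u - ?p) \<le> r k" by (simp add: dist_norm)
    moreover from this have "u - ?p \<in> enriched (E k) UNIV"
      using patched_near_centre[of "u - ?p" k \<psi>] k(1) u(1) r_le[of k] by simp
    ultimately have "u - ?p \<in> D" by (simp add: D_def)
    moreover have "y = g (u - ?p)" by (simp add: g_def u(2))
    ultimately show ?thesis by blast
  qed
  ultimately show False
    using rigid[of k] unfolding rigid_patch_def Let_def D_def[symmetric] by blast
qed

end

section \<open>An uncountable family of nets\<close>

lemma bilipschitz_equivalent_refl: "bilipschitz_equivalent X X"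
proof -
  have "inv_into X id x = x" if "x \<in> X" for x
    using inv_into_f_f[of id X x] that by simp
  then have "1-lipschitz_on X (inv_into X id)"
    by (intro lipschitz_onI) auto
  moreover have "1-lipschitz_on X id"
    by (intro lipschitz_onI) auto
  ultimately show ?thesis
    unfolding bilipschitz_equivalent_def using bij_betw_id by blast
qed

theorem theorem6p1:
  fixes \<phi> :: "real \<Rightarrow> real"
  assumes dim: "CARD('n::finite) \<ge> 2"
    and pos: "\<forall>t>0. \<phi> t > 0"
    and unbounded: "\<not> bounded (\<phi> ` {0<..})"
    and increasing: "mono_on {0<..} \<phi>"
    and concave: "concave_on {0<..} \<phi>"
  shows "\<exists>(\<Lambda> :: (real ^ 'n) set set) (X :: (real ^ 'n) set \<Rightarrow> (real ^ 'n) set).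
           uncountable \<Lambda> \<and>
           (\<forall>\<psi>\<in>\<Lambda>. separated_net (X \<psi>)) \<and>
           (\<forall>\<psi>\<in>\<Lambda>. \<forall>\<psi>'\<in>\<Lambda>. \<psi> \<noteq> \<psi>' \<longrightarrow> \<not> bilipschitz_equivalent (X \<psi>) (X \<psi>')) \<and>
           (\<forall>\<psi>\<in>\<Lambda>. displacement_equivalent \<phi> (X \<psi>) integer_lattice)"
proof -
  have "\<forall>k. \<exists>E r. rigid_patch (real k + 1) (E :: (int ^ 'n) set) r"
    using rigid_patch_exists[OF dim] by simp
  then obtain E :: "nat \<Rightarrow> (int ^ 'n) set" and r where rigid: "\<And>k. rigid_patch (real k + 1) (E k) (r k)"
    by metis
  have "\<exists>\<rho>::nat. 1 \<le> real \<rho> \<and> r k \<le> \<rho> \<and> (\<forall>z\<in>E k. norm (emb z) \<le> \<rho> \<and> norm (emb z + half) \<le> \<rho>)" for k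
  proof -
    have "finite (E k)" using rigid[of k] by (simp add: rigid_patch_def)
    obtain \<rho> :: nat where \<rho>: "1 + \<bar>r k\<bar> + (\<Sum>z\<in>E k. norm (emb z) + norm (emb z + half)) \<le> \<rho>"
      using real_arch_simple by blast
    have nonneg: "0 \<le> (\<Sum>z\<in>E k. norm (emb z) + norm (emb z + half))" by (intro sum_nonneg) auto
    have "norm (emb z) + norm (emb z + half) \<le> \<rho>" if "z \<in> E k" for z
      using member_le_sum[OF that, of "\<lambda>z. norm (emb z) + norm (emb z + half)"] \<open>finite (E k)\<close> \<rho> by auto
    then have "norm (emb z) \<le> \<rho> \<and> norm (emb z + half) \<le> \<rho>" if "z \<in> E k" for z
      using that norm_ge_zero[of "emb z"] norm_ge_zero[of "emb z + half"] by (smt (verit))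
    moreover have "1 \<le> real \<rho>" "r k \<le> \<rho>" using \<rho> nonneg by linarith+
    ultimately show ?thesis by blast
  qed
  then obtain \<rho> :: "nat \<Rightarrow> nat" where \<rho>: "\<And>k. 1 \<le> real (\<rho> k)" "\<And>k. r k \<le> \<rho> k"
    "\<And>k z. z \<in> E k \<Longrightarrow> norm (emb z) \<le> \<rho> k" "\<And>k z. z \<in> E k \<Longrightarrow> norm (emb z + half) \<le> \<rho> k"
    by metis
  then have "\<And>k. 1 \<le> \<rho> k" by simp
  have "\<exists>c0. \<forall>c\<ge>c0. 6 * \<rho> k < c \<and> (\<forall>R\<ge>real c - 6 * \<rho> k. 12 * \<rho> k \<le> \<phi> R)" for k
  proof -
    obtain t where t: "0 < t" "12 * \<rho> k \<le> \<phi> t"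
    proof (rule ccontr)
      assume "\<not> thesis"
      with that have "\<phi> t \<le> 12 * \<rho> k" if "0 < t" for t using \<open>0 < t\<close> by force
      then have "bounded (\<phi> ` {0<..})"
        using pos by (intro boundedI[of _ "12 * \<rho> k"]) (auto simp: less_imp_le)
      with unbounded show False by simp
    qed
    obtain c0 :: nat where c0: "6 * \<rho> k + t \<le> c0" using real_arch_simple by blast
    have "6 * \<rho> k < c \<and> (\<forall>R\<ge>real c - 6 * \<rho> k. 12 * \<rho> k \<le> \<phi> R)" if "c0 \<le> c" for c
    proof (intro conjI allI impI)
      have "6 * \<rho> k + t \<le> c" using c0 that by simp
      then show "6 * \<rho> k < c" using t(1) by linarith
      fix R assume "real c - 6 * \<rho> k \<le> R"
      then have "t \<le> R" using \<open>6 * \<rho> k + t \<le> c\<close> by simp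
      then have "\<phi> t \<le> \<phi> R" using increasing t(1) by (auto simp: mono_on_def)
      with t(2) show "12 * \<rho> k \<le> \<phi> R" by simp
    qed
    then show ?thesis by blast
  qed
  from growing_sequence[where P = "\<lambda>k c. 6 * \<rho> k < c \<and> (\<forall>R\<ge>real c - 6 * \<rho> k. 12 * \<rho> k \<le> \<phi> R)", OF this, where G = "\<lambda>j k cj. (k + 2) * (cj + 10 * \<rho> j + 10 * \<rho> k + k + 1)"]
  obtain c where c: "\<And>k. even (c k)"
    "\<And>k. 6 * \<rho> k < c k \<and> (\<forall>R\<ge>real (c k) - 6 * \<rho> k. 12 * \<rho> k \<le> \<phi> R)"
    "\<And>j k. j < k \<Longrightarrow> (k + 2) * (c j + 10 * \<rho> j + 10 * \<rho> k + k + 1) \<le> c k"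
    by blast
  interpret patched_lattice "undefined :: 'n" c \<rho> E
    by unfold_locales (use \<rho> \<open>\<And>k. 1 \<le> \<rho> k\<close> c in blast)+
  define Y where "Y A = patched (prefix_codes A)" for A
  \<comment> \<open>distinct index sets give inequivalent, in particular distinct, nets\<close>
  have inequivalent: "\<not> bilipschitz_equivalent (Y A) (Y B)" if "A \<noteq> B" for A B
    unfolding Y_def by (rule not_bilipschitz_equivalent_patched[OF rigid \<rho>(2) infinite_prefix_codes_diff[OF that]])
  then have "inj Y" using bilipschitz_equivalent_refl by (metis injI)
  then have "uncountable (range Y)"
    using uncountable_nat_sets by (metis countable_image_inj_eq)
  moreover have "separated_net (Y A)" "displacement_equivalent \<phi> (Y A) integer_lattice" for A
    using separated_patched net_patched displacement_equivalent_patched[of \<phi>] c(2) pos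
    by (auto simp: Y_def separated_net_def)
  moreover have "\<forall>Z\<in>range Y. \<forall>Z'\<in>range Y. Z \<noteq> Z' \<longrightarrow> \<not> bilipschitz_equivalent Z Z'"
  proof (intro ballI impI)
    fix Z Z' assume "Z \<in> range Y" "Z' \<in> range Y" "Z \<noteq> Z'"
    then obtain A B where AB: "Z = Y A" "Z' = Y B" by blast
    with \<open>Z \<noteq> Z'\<close> have "A \<noteq> B" by auto
    then show "\<not> bilipschitz_equivalent Z Z'" unfolding AB by (rule inequivalent)
  qed
  ultimately show ?thesis
    by (intro exI[of _ "range Y"] exI[of _ id]) auto
qed

end
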